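(* There exists a constant $C>0$ such that for any nonempty open bounded convex set $E\subset\mathbb{R}^2$, $$\frac{1}{(2\pi)^2}-\frac{\inf_{x_0\in\mathbb{R}^2}\int_{\partial E}|x-x_0|^2\,d\mathcal{H}^1}{P(E)^3}\ge C\,\mathcal{A}_{\mathcal{H}}(E)^2 .$$
   Context: $P(E)=\mathcal{H}^1(\partial E)$ is the perimeter. The asymmetry index is $$\mathcal{A}_{\mathcal{H}}(E)=\min_{x_0\in\mathbb{R}^2}\left\{\frac{d_{\mathcal{H}}(E,B_r(x_0))}{r}\;:\;P(E)=P(B_r)\right\},$$ i.e. $r>0$ is determined by $P(B_r)=P(E)$, and $d_{\mathcal{H}}$ is the Hausdorff distance (for open bounded convex sets, the usual Hausdorff distance of their closures). *)

theory Defs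
  imports "HOL-Analysis.Analysis"
begin

section \<open>One-dimensional Hausdorff measure\<close>

text \<open>
  The normalising constant of the \<open>s\<close>-dimensional Hausdorff measure is \<open>1\<close> for \<open>s = 1\<close>, so the
  diameters are summed as they are. Boundedness of the covering sets is required explicitly because
  \<^const>\<open>diameter\<close> takes a meaningless value on unbounded sets.
\<close>

definition hausdorff1_pre :: "real \<Rightarrow> 'a::metric_space set \<Rightarrow> ennreal" where
  "hausdorff1_pre \<delta> A =
    (INF C\<in>{C :: nat \<Rightarrow> 'a set. A \<subseteq> (\<Union>i. C i) \<and> (\<forall>i. bounded (C i) \<and> diameter (C i) \<le> \<delta>)}.
      \<Sum>i. ennreal (diameter (C i)))"

definition hausdorff1_outer :: "'a::metric_space set \<Rightarrow> ennreal" where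
  "hausdorff1_outer A = (SUP \<delta>\<in>{0<..}. hausdorff1_pre \<delta> A)"

text \<open>
  \<^const>\<open>measure_of\<close> yields the zero measure if the given set function is not countably additive;
  theorem \<open>emeasure_hausdorff1\<close> below shows that this does not happen here.
\<close>

definition hausdorff1 :: "'a::metric_space measure" where
  "hausdorff1 = measure_of UNIV (sets borel) hausdorff1_outer"

lemma hausdorff1_pre_le:
  assumes "A \<subseteq> (\<Union>i. C i)" "\<And>i. bounded (C i)" "\<And>i. diameter (C i) \<le> \<delta>"
  shows "hausdorff1_pre \<delta> A \<le> (\<Sum>i::nat. ennreal (diameter (C i)))"
  unfolding hausdorff1_pre_def using assms by (intro INF_lower) auto

lemma hausdorff1_pre_mono: "A \<subseteq> B \<Longrightarrow> hausdorff1_pre \<delta> A \<le> hausdorff1_pre \<delta> B"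
  unfolding hausdorff1_pre_def by (rule INF_superset_mono) auto

lemma hausdorff1_pre_antimono: "\<delta> \<le> \<delta>' \<Longrightarrow> hausdorff1_pre \<delta>' A \<le> hausdorff1_pre \<delta> A"
  unfolding hausdorff1_pre_def by (rule INF_superset_mono) (auto intro: order_trans)

lemma hausdorff1_outer_mono: "A \<subseteq> B \<Longrightarrow> hausdorff1_outer A \<le> hausdorff1_outer B"
  unfolding hausdorff1_outer_def by (intro SUP_mono') (auto intro: hausdorff1_pre_mono)

lemma hausdorff1_pre_le_outer: "\<delta> > 0 \<Longrightarrow> hausdorff1_pre \<delta> A \<le> hausdorff1_outer A"
  unfolding hausdorff1_outer_def by (intro SUP_upper) auto

lemma hausdorff1_outer_empty [simp]: "hausdorff1_outer {} = 0"
proof -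
  have "hausdorff1_pre \<delta> ({}::'a set) \<le> 0" if "\<delta> > 0" for \<delta>
    using hausdorff1_pre_le[of "{}" "\<lambda>_. {}" \<delta>] that by simp
  then have "hausdorff1_outer ({}::'a set) \<le> 0"
    unfolding hausdorff1_outer_def by (intro SUP_least) auto
  then show ?thesis by simp
qed

lemma hausdorff1_pre_countably_subadditive:
  "hausdorff1_pre \<delta> (\<Union>n. A n) \<le> (\<Sum>n::nat. hausdorff1_pre \<delta> (A n))"
proof (rule ennreal_le_epsilon)
  fix e :: real assume fin: "(\<Sum>n. hausdorff1_pre \<delta> (A n)) < top" and e: "0 < e"
  define d where "d n = ennreal (e * (1/2) ^ Suc n)" for n
  have dpos: "d n > 0" for n
    using e by (simp add: d_def)
  have "\<exists>C. A n \<subseteq> (\<Union>i::nat. C i) \<and> (\<forall>i. bounded (C i) \<and> diameter (C i) \<le> \<delta>) \<and>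
          (\<Sum>i. ennreal (diameter (C i))) \<le> hausdorff1_pre \<delta> (A n) + d n" for n
  proof -
    have "hausdorff1_pre \<delta> (A n) < top"
      using fin by (metis ennreal_suminf_lessD)
    then have "hausdorff1_pre \<delta> (A n) < hausdorff1_pre \<delta> (A n) + d n"
      using dpos[of n] by (simp add: ennreal_add_left_cancel_less[of _ 0, simplified] less_top)
    then show ?thesis
      unfolding hausdorff1_pre_def[of \<delta> "A n"] INF_less_iff by (auto intro: less_imp_le)
  qed
  then obtain C where C: "\<And>n. A n \<subseteq> (\<Union>i::nat. C n i)"
      "\<And>n i. bounded (C n i)" "\<And>n i. diameter (C n i) \<le> \<delta>"
      "\<And>n. (\<Sum>i. ennreal (diameter (C n i))) \<le> hausdorff1_pre \<delta> (A n) + d n"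
    by metis
  define D where "D k = (case prod_decode k of (n, i) \<Rightarrow> C n i)" for k
  have "(\<Union>n. A n) \<subseteq> (\<Union>k. D k)"
  proof
    fix x assume "x \<in> (\<Union>n. A n)"
    then obtain n i where "x \<in> C n i"
      using C(1) by blast
    then have "x \<in> D (prod_encode (n, i))"
      by (simp add: D_def)
    then show "x \<in> (\<Union>k. D k)"
      by blast
  qed
  then have "hausdorff1_pre \<delta> (\<Union>n. A n) \<le> (\<Sum>k. ennreal (diameter (D k)))"
    using C by (intro hausdorff1_pre_le) (auto simp: D_def split: prod.split)
  also have "\<dots> = (\<Sum>k. (\<lambda>(n, i). ennreal (diameter (C n i))) (prod_decode k))"
    by (simp add: D_def case_prod_beta)
  also have "\<dots> = (\<Sum>n i. ennreal (diameter (C n i)))"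
    by (rule suminf_ennreal_2dimen) simp
  also have "\<dots> \<le> (\<Sum>n. hausdorff1_pre \<delta> (A n) + d n)"
    by (intro suminf_le C) auto
  also have "\<dots> = (\<Sum>n. hausdorff1_pre \<delta> (A n)) + (\<Sum>n. d n)"
    by (intro suminf_add[symmetric]) auto
  also have "(\<Sum>n. d n) = ennreal e"
    unfolding d_def using e sums_mult[OF power_half_series, of e]
    by (intro suminf_ennreal_eq) auto
  finally show "hausdorff1_pre \<delta> (\<Union>n. A n) \<le> (\<Sum>n. hausdorff1_pre \<delta> (A n)) + ennreal e" .
qed

lemma hausdorff1_outer_countably_subadditive:
  "hausdorff1_outer (\<Union>n. A n) \<le> (\<Sum>n::nat. hausdorff1_outer (A n))"
proof -
  have "hausdorff1_pre \<delta> (\<Union>n. A n) \<le> (\<Sum>n. hausdorff1_outer (A n))" if "\<delta> > 0" for \<delta>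
    by (rule order_trans[OF hausdorff1_pre_countably_subadditive])
      (intro suminf_le hausdorff1_pre_le_outer that; simp)
  then show ?thesis
    unfolding hausdorff1_outer_def[of "\<Union>n. A n"] by (intro SUP_least) auto
qed

lemma outer_measure_space_hausdorff1: "outer_measure_space UNIV hausdorff1_outer"
  unfolding outer_measure_space_def positive_def increasing_def countably_subadditive_def
  by (auto simp: hausdorff1_outer_mono hausdorff1_outer_countably_subadditive)

lemma hausdorff1_outer_Un: "hausdorff1_outer (A \<union> B) \<le> hausdorff1_outer A + hausdorff1_outer B"
proof -
  have "A \<union> B = (\<Union>n::nat. if n = 0 then A else if n = 1 then B else {})"
    by (auto split: if_splits)
  then have "hausdorff1_outer (A \<union> B)
      \<le> (\<Sum>n::nat. hausdorff1_outer (if n = 0 then A else if n = 1 then B else {}))"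
    using hausdorff1_outer_countably_subadditive by metis
  also have "\<dots> = (\<Sum>n\<in>{0, 1::nat}. hausdorff1_outer (if n = 0 then A else if n = 1 then B else {}))"
    by (intro suminf_finite) auto
  finally show ?thesis by simp
qed

lemma hausdorff1_outer_separated:
  assumes e: "e > 0" and sep: "\<And>x y. x \<in> A \<Longrightarrow> y \<in> B \<Longrightarrow> e \<le> dist x y"
  shows "hausdorff1_outer A + hausdorff1_outer B \<le> hausdorff1_outer (A \<union> B)"
proof -
  have pre: "hausdorff1_pre \<delta> A + hausdorff1_pre \<delta> B \<le> hausdorff1_pre \<delta> (A \<union> B)"
    if \<delta>: "0 < \<delta>" "\<delta> < e" for \<delta>
    unfolding hausdorff1_pre_def[of \<delta> "A \<union> B"]
  proof (rule INF_greatest, clarify)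
    fix C :: "nat \<Rightarrow> 'a set"
    assume cov: "A \<union> B \<subseteq> (\<Union>i. C i)" and C: "\<forall>i. bounded (C i) \<and> diameter (C i) \<le> \<delta>"
    define CA where "CA i = (if C i \<inter> A = {} then {} else C i)" for i
    define CB where "CB i = (if C i \<inter> B = {} then {} else C i)" for i
    have "A \<subseteq> (\<Union>i. CA i)" "B \<subseteq> (\<Union>i. CB i)"
      using cov unfolding CA_def CB_def by (fastforce split: if_splits)+
    then have "hausdorff1_pre \<delta> A + hausdorff1_pre \<delta> B
        \<le> (\<Sum>i. ennreal (diameter (CA i))) + (\<Sum>i. ennreal (diameter (CB i)))"
      using C \<delta> by (intro add_mono hausdorff1_pre_le) (auto simp: CA_def CB_def)
    also have "\<dots> = (\<Sum>i. ennreal (diameter (CA i)) + ennreal (diameter (CB i)))"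
      by (intro suminf_add) auto
    also have "\<dots> \<le> (\<Sum>i. ennreal (diameter (C i)))"
    proof (intro suminf_le)
      fix i
      have "C i \<inter> A = {} \<or> C i \<inter> B = {}"
      proof (rule ccontr)
        assume "\<not> ?thesis"
        then obtain x y where xy: "x \<in> C i" "x \<in> A" "y \<in> C i" "y \<in> B" by blast
        then have "dist x y \<le> \<delta>"
          using C diameter_bounded_bound[of "C i" x y] by (meson order_trans)
        with sep[of x y] xy \<delta> show False by simp
      qed
      then show "ennreal (diameter (CA i)) + ennreal (diameter (CB i)) \<le> ennreal (diameter (C i))"
        by (auto simp: CA_def CB_def)
    qed auto
    finally show "hausdorff1_pre \<delta> A + hausdorff1_pre \<delta> B \<le> (\<Sum>i. ennreal (diameter (C i)))" .
  qed
  have *: "hausdorff1_pre \<delta> A + hausdorff1_pre \<delta>' B \<le> hausdorff1_outer (A \<union> B)"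
    if "0 < \<delta>" "0 < \<delta>'" for \<delta> \<delta>'
  proof -
    define \<gamma> where "\<gamma> = min (e/2) (min \<delta> \<delta>')"
    have \<gamma>: "0 < \<gamma>" "\<gamma> < e" "\<gamma> \<le> \<delta>" "\<gamma> \<le> \<delta>'"
      using that e by (auto simp: \<gamma>_def)
    have "hausdorff1_pre \<delta> A + hausdorff1_pre \<delta>' B \<le> hausdorff1_pre \<gamma> A + hausdorff1_pre \<gamma> B"
      by (intro add_mono hausdorff1_pre_antimono \<gamma>)
    also have "\<dots> \<le> hausdorff1_pre \<gamma> (A \<union> B)"
      by (rule pre[OF \<gamma>(1,2)])
    also have "\<dots> \<le> hausdorff1_outer (A \<union> B)"
      by (rule hausdorff1_pre_le_outer[OF \<gamma>(1)])
    finally show ?thesis .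
  qed
  have ne: "{0::real<..} \<noteq> {}" by (auto intro: exI[of _ 1])
  show ?thesis
    unfolding hausdorff1_outer_def[of A] hausdorff1_outer_def[of B]
    by (subst ennreal_SUP_add_left[OF ne, symmetric], rule SUP_least,
        subst ennreal_SUP_add_right[OF ne], rule SUP_least) (simp_all add: *)
qed

lemma hausdorff1_outer_sum_separated:
  assumes "\<And>i j. i < j \<Longrightarrow> j < n \<Longrightarrow> \<exists>e>0. \<forall>x\<in>R i. \<forall>y\<in>R j. e \<le> dist x y"
  shows "(\<Sum>k<n. hausdorff1_outer (R k)) \<le> hausdorff1_outer (\<Union>k<n::nat. R k)"
  using assms
proof (induction n)
  case (Suc n)
  have "\<forall>i\<in>{..<n}. \<exists>e>0. \<forall>x\<in>R i. \<forall>y\<in>R n. e \<le> dist x y"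
    using Suc.prems by auto
  then obtain e where e: "\<And>i. i < n \<Longrightarrow> e i > 0"
      "\<And>i x y. i < n \<Longrightarrow> x \<in> R i \<Longrightarrow> y \<in> R n \<Longrightarrow> e i \<le> dist x y"
    by (metis lessThan_iff)
  define m where "m = Min (insert 1 (e ` {..<n}))"
  have m: "m > 0" "\<And>i. i < n \<Longrightarrow> m \<le> e i"
    using e(1) by (auto simp: m_def)
  have "(\<Sum>k<Suc n. hausdorff1_outer (R k)) \<le> hausdorff1_outer (\<Union>k<n. R k) + hausdorff1_outer (R n)"
    using Suc by (simp add: add_right_mono)
  also have "\<dots> \<le> hausdorff1_outer ((\<Union>k<n. R k) \<union> R n)"
    using m(1)
  proof (rule hausdorff1_outer_separated)
    fix x y assume "x \<in> (\<Union>k<n. R k)" "y \<in> R n"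
    then show "m \<le> dist x y"
      using e(2) m(2) by (meson UN_E lessThan_iff order_trans)
  qed
  also have "(\<Union>k<n. R k) \<union> R n = (\<Union>k<Suc n. R k)"
    by (auto simp: lessThan_Suc)
  finally show ?case .
qed simp

lemma ennreal_tail:
  fixes f :: "nat \<Rightarrow> ennreal"
  assumes "(\<Sum>k. f k) \<noteq> top"
  shows "(\<lambda>n. \<Sum>k. f (k + n)) \<longlonglongrightarrow> 0"
proof -
  define g where "g k = enn2real (f k)" for k
  have f: "f k = ennreal (g k)" and g0: "g k \<ge> 0" for k
    using ennreal_suminf_lessD[of f top k] assms by (auto simp: g_def less_top)
  have sm: "summable g"
    using assms g0 by (intro summable_suminf_not_top) (auto simp: f)
  have "(\<Sum>k. f (k + n)) = ennreal (\<Sum>k. g (k + n))" for n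
    unfolding f using sm g0 by (intro suminf_ennreal2) (auto simp: summable_iff_shift)
  moreover have "(\<lambda>n. ennreal (\<Sum>k. g (k + n))) \<longlonglongrightarrow> ennreal 0"
    using suminf_exist_split2[OF sm] by (intro tendsto_ennrealI)
  ultimately show ?thesis by simp
qed

lemma closed_hausdorff1_measurable:
  fixes F :: "'a::metric_space set"
  assumes F: "closed F"
  shows "hausdorff1_outer (T \<inter> F) + hausdorff1_outer (T - F) \<le> hausdorff1_outer T"
proof (cases "F = {} \<or> hausdorff1_outer T = top")
  case True
  then show ?thesis by auto
next
  case False
  then have Fne: "F \<noteq> {}" and fin: "hausdorff1_outer T < top"
    by (auto simp: less_top)
  define r where "r n = 1 / (real n + 1)" for n
  have rpos: "r n > 0" for n by (simp add: r_def)
  have rless: "r j < r i" if "i < j" for i j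
    using that by (simp add: r_def field_simps)
  have dist_inf: "infdist x F \<le> infdist y F + dist x y" for x y
    by (rule infdist_triangle)
  define S where "S n = {x\<in>T. r n \<le> infdist x F}" for n
  define R where "R n = {x\<in>T. r (Suc n) \<le> infdist x F \<and> infdist x F < r n}" for n
  have RT: "R n \<subseteq> T" for n by (auto simp: R_def)
  have sepR: "\<exists>e>0. \<forall>x\<in>R i. \<forall>y\<in>R j. e \<le> dist x y" if "Suc i < j" for i j
  proof (intro exI[of _ "r (Suc i) - r j"] conjI ballI)
    show "r (Suc i) - r j > 0" using rless[OF that] by simp
    fix x y assume "x \<in> R i" "y \<in> R j"
    then show "r (Suc i) - r j \<le> dist x y"
      using dist_inf[of x y] by (auto simp: R_def)
  qed
  have bound: "(\<Sum>k. hausdorff1_outer (R (2 * k + c))) \<le> hausdorff1_outer T" for c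
  proof (rule suminf_le_const)
    fix n
    have "(\<Sum>k<n. hausdorff1_outer (R (2 * k + c))) \<le> hausdorff1_outer (\<Union>k<n. R (2 * k + c))"
      by (intro hausdorff1_outer_sum_separated sepR) auto
    also have "\<dots> \<le> hausdorff1_outer T"
      using RT by (intro hausdorff1_outer_mono) auto
    finally show "(\<Sum>k<n. hausdorff1_outer (R (2 * k + c))) \<le> hausdorff1_outer T" .
  qed auto
  have "(\<Sum>k. hausdorff1_outer (R k)) \<le> hausdorff1_outer T + hausdorff1_outer T"
  proof (rule suminf_le_const)
    fix n
    have "(\<Sum>k<n. hausdorff1_outer (R k)) \<le> (\<Sum>k<2*n. hausdorff1_outer (R k))"
      by (intro sum_mono2) auto
    also have "\<dots> = (\<Sum>k<n. hausdorff1_outer (R (2 * k + 0))) + (\<Sum>k<n. hausdorff1_outer (R (2 * k + 1)))"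
      by (induction n) (auto simp: algebra_simps)
    also have "\<dots> \<le> (\<Sum>k. hausdorff1_outer (R (2 * k + 0))) + (\<Sum>k. hausdorff1_outer (R (2 * k + 1)))"
      by (intro add_mono sum_le_suminf) auto
    also have "\<dots> \<le> hausdorff1_outer T + hausdorff1_outer T"
      by (intro add_mono bound)
    finally show "(\<Sum>k<n. hausdorff1_outer (R k)) \<le> hausdorff1_outer T + hausdorff1_outer T" .
  qed auto
  also have "\<dots> < top" using fin by simp
  finally have Rfin: "(\<Sum>k. hausdorff1_outer (R k)) \<noteq> top" by (simp add: less_top)
  then have tail: "(\<lambda>n. \<Sum>k. hausdorff1_outer (R (k + n))) \<longlonglongrightarrow> 0"
    by (rule ennreal_tail)
  have main: "hausdorff1_outer (T \<inter> F) + hausdorff1_outer (T - F)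
      \<le> hausdorff1_outer T + (\<Sum>k. hausdorff1_outer (R (k + n)))" for n
  proof -
    have "T - F \<subseteq> S n \<union> (\<Union>k. R (k + n))"
    proof
      fix x assume x: "x \<in> T - F"
      then have pos: "infdist x F > 0"
        using F Fne by (simp add: infdist_pos_not_in_closed)
      show "x \<in> S n \<union> (\<Union>k. R (k + n))"
      proof (cases "r n \<le> infdist x F")
        case True
        then show ?thesis using x by (auto simp: S_def)
      next
        case False
        obtain m where m: "r m < infdist x F"
          using reals_Archimedean[OF pos] by (auto simp: r_def inverse_eq_divide algebra_simps)
        define p where "p = (LEAST m. r m \<le> infdist x F)"
        have p1: "r p \<le> infdist x F"
          unfolding p_def by (rule LeastI[of _ m]) (use m in simp)
        have "n < p"
        proof (rule ccontr)
          assume "\<not> n < p"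
          then have "r n \<le> r p" by (simp add: r_def frac_le)
          with p1 False show False by simp
        qed
        then obtain q where q: "p = Suc q" "n \<le> q"
          by (cases p) auto
        have "\<not> r q \<le> infdist x F"
          using not_less_Least[of q "\<lambda>m. r m \<le> infdist x F"] q by (simp add: p_def)
        then have "x \<in> R ((q - n) + n)"
          using p1 q x by (simp add: R_def)
        then show ?thesis by blast
      qed
    qed
    then have "hausdorff1_outer (T - F) \<le> hausdorff1_outer (S n \<union> (\<Union>k. R (k + n)))"
      by (rule hausdorff1_outer_mono)
    also have "\<dots> \<le> hausdorff1_outer (S n) + hausdorff1_outer (\<Union>k. R (k + n))"
      by (rule hausdorff1_outer_Un)
    also have "\<dots> \<le> hausdorff1_outer (S n) + (\<Sum>k. hausdorff1_outer (R (k + n)))"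
      by (intro add_left_mono hausdorff1_outer_countably_subadditive)
    finally have 1: "hausdorff1_outer (T - F) \<le> \<dots>" .
    have "hausdorff1_outer (T \<inter> F) + hausdorff1_outer (S n) \<le> hausdorff1_outer (T \<inter> F \<union> S n)"
      using rpos[of n]
    proof (rule hausdorff1_outer_separated)
      fix x y assume "x \<in> T \<inter> F" "y \<in> S n"
      then show "r n \<le> dist x y"
        using infdist_le[of x F y] by (auto simp: S_def dist_commute)
    qed
    also have "\<dots> \<le> hausdorff1_outer T"
      by (intro hausdorff1_outer_mono) (auto simp: S_def)
    finally have 2: "hausdorff1_outer (T \<inter> F) + hausdorff1_outer (S n) \<le> hausdorff1_outer T" .
    have "hausdorff1_outer (T \<inter> F) + hausdorff1_outer (T - F)
        \<le> (hausdorff1_outer (T \<inter> F) + hausdorff1_outer (S n)) + (\<Sum>k. hausdorff1_outer (R (k + n)))"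
      using add_left_mono[OF 1] by (simp add: add.assoc)
    also have "\<dots> \<le> hausdorff1_outer T + (\<Sum>k. hausdorff1_outer (R (k + n)))"
      by (rule add_right_mono[OF 2])
    finally show ?thesis .
  qed
  have "(\<lambda>n. hausdorff1_outer T + (\<Sum>k. hausdorff1_outer (R (k + n)))) \<longlonglongrightarrow> hausdorff1_outer T + 0"
    by (intro tendsto_add tendsto_const tail)
  then show ?thesis
    using main by (intro LIMSEQ_le_const) auto
qed

lemma measure_space_hausdorff1:
  "measure_space UNIV (sets borel) (hausdorff1_outer :: 'a::metric_space set \<Rightarrow> ennreal)"
proof -
  interpret S: sigma_algebra "UNIV :: 'a set" UNIV
    using sigma_algebra_Pow[of "UNIV :: 'a set"] by simp
  let ?L = "lambda_system UNIV UNIV (hausdorff1_outer :: 'a set \<Rightarrow> ennreal)"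
  have ms: "measure_space UNIV ?L hausdorff1_outer"
    by (rule S.caratheodory_lemma[OF outer_measure_space_hausdorff1])
  interpret L: sigma_algebra UNIV ?L
    using ms by (simp add: measure_space_def)
  have "Collect closed \<subseteq> ?L"
  proof clarify
    fix F :: "'a set" assume F: "closed F"
    have "hausdorff1_outer (T \<inter> F) + hausdorff1_outer (T - F) = hausdorff1_outer T" for T
      using closed_hausdorff1_measurable[OF F, of T] hausdorff1_outer_Un[of "T \<inter> F" "T - F"]
      by (simp add: Int_Diff_Un antisym)
    then show "F \<in> ?L"
      by (simp add: S.lambda_system_eq)
  qed
  then have "sigma_sets UNIV (Collect closed) \<subseteq> ?L"
    by (rule L.sigma_sets_subset)
  then have sub: "sets borel \<subseteq> ?L"
    by (simp add: borel_eq_closed)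
  show ?thesis
    by (rule measure_down[OF ms _ sub]) (metis sets.sigma_algebra_axioms space_borel)
qed

lemma sets_hausdorff1 [simp, measurable_cong]: "sets hausdorff1 = sets borel"
  unfolding hausdorff1_def by (metis sets.sigma_sets_eq sets.top sets_measure_of space_borel subset_UNIV Pow_UNIV)

lemma space_hausdorff1 [simp]: "space hausdorff1 = UNIV"
  using sets_eq_imp_space_eq[OF sets_hausdorff1] by simp

theorem emeasure_hausdorff1:
  "A \<in> sets borel \<Longrightarrow> emeasure hausdorff1 A = hausdorff1_outer A"
  unfolding hausdorff1_def
  using measure_space_hausdorff1
  by (intro emeasure_measure_of_sigma) (auto simp: measure_space_def)


section \<open>Perimeter, Hausdorff distance and asymmetry\<close>

text \<open>
  The boundary of a bounded convex set has finite \<^const>\<open>hausdorff1\<close>-measure, so the passage from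
  \<^typ>\<open>ennreal\<close> to \<^typ>\<open>real\<close> in \<^const>\<open>measure\<close> loses nothing for such sets, and every bounded
  Borel function is integrable over the boundary.
\<close>

definition perimeter :: "(real^2) set \<Rightarrow> real" where
  "perimeter E = measure hausdorff1 (frontier E)"

text \<open>Meaningful for nonempty bounded sets, where both suprema are finite.\<close>

definition hausdorff_dist :: "'a::metric_space set \<Rightarrow> 'a set \<Rightarrow> real" where
  "hausdorff_dist A B = max (SUP a\<in>A. infdist a B) (SUP b\<in>B. infdist b A)"

text \<open>
  The radius \<open>r\<close> is determined by the perimeter constraint, and the infimum over \<open>x\<^sub>0\<close> is attained,
  since the distance is continuous in \<open>x\<^sub>0\<close> and tends to infinity with it.
\<close>

definition asymmetry :: "(real^2) set \<Rightarrow> real" where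
  "asymmetry E =
    Inf {hausdorff_dist (closure E) (closure (ball x\<^sub>0 r)) / r | x\<^sub>0 r.
         r > 0 \<and> perimeter (ball x\<^sub>0 r) = perimeter E}"

end

theory Submission
  imports Defs "HOL-Probability.Distribution_Functions" "HOL-Real_Asymp.Real_Asymp"
begin

text \<open>
  Let the perimeter be \<open>2 * pi\<close>, and let the boundary be a closed curve, parametrized by arc length, with
  barycentre \<open>0\<close>. In terms of its Fourier coefficients \<open>b j\<close>, the second moment is \<open>2 * pi\<close> times the sum of
  \<open>(norm (b j))\<^sup>2\<close>, and the sum of \<open>j\<^sup>2 * (norm (b j))\<^sup>2\<close> is at most \<open>1\<close>, because the curve has speed at most \<open>1\<close>.
  Hence the second moment is at most that of the unit circle (this is Wirtinger's inequality), and the deficit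
  controls all frequencies other than \<open>1\<close> and \<open>-1\<close>, even in the supremum norm. These two
  frequencies together describe an ellipse. That the speed is bounded by \<open>1\<close> at every point, and close to \<open>1\<close> in
  mean square, forces the product of the two coefficients to be of the order of the square root of the
  deficit. So the curve is uniformly close, to that order, to a unit circle run through in one of the two
  directions, and since closed bounded convex sets are the convex hulls of their boundaries, the set is
  close to a disc in Hausdorff distance.

  The argument is carried out for polygons instead of curves, which replaces derivatives and Fourier
  series by finite sums. The boundary is a homeomorphic image of the circle and has finite length, so it can
  be cut into \<open>n\<close> arcs of length \<open>L / n\<close> (\<open>arc_mass_function\<close>, \<open>equal_mass_partition\<close>); the division points span a closed
  polygon whose sides are at most \<open>L / n\<close>, since a connected set is at least as long as the distance of
  any two of its points (\<open>dist_le_hausdorff1_outer_connected\<close>). The inequality for polygons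
  (\<open>polygon_wirtinger_stability\<close>) is sharp for regular \<open>n\<close>-gons and has constants independent of \<open>n\<close>, so letting \<open>n\<close> tend
  to infinity in \<open>asymmetry_le_discrete\<close> gives the claim.
\<close>

section \<open>Hausdorff measure of connected sets and of Lipschitz curves\<close>

text \<open>
  The distance function from \<open>x\<close> is 1-Lipschitz, so it maps a cover of \<open>A\<close> to a cover of an interval of
  length \<open>dist x y\<close> by sets whose Lebesgue measures are at most the diameters of the original pieces.
\<close>

lemma dist_le_hausdorff1_outer_connected:
  fixes A :: "'a::metric_space set"
  assumes conn: "connected A" and "x \<in> A" "y \<in> A"
  shows "ennreal (dist x y) \<le> hausdorff1_outer A"
proof -
  have "ennreal (dist x y) \<le> (\<Sum>i. ennreal (diameter (C i)))"
    if cov: "A \<subseteq> (\<Union>i. C i)" and C: "\<forall>i. bounded (C i) \<and> diameter (C i) \<le> 1"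
    for C :: "nat \<Rightarrow> 'a set"
  proof -
    have "\<exists>J. dist x ` C i \<subseteq> J \<and> J \<in> sets borel \<and> emeasure lborel J \<le> ennreal (diameter (C i))" for i
    proof (cases "C i = {}")
      case False
      define u where "u = Inf (dist x ` C i)"
      have bdd: "bdd_below (dist x ` C i)"
        by (rule bdd_belowI[of _ 0]) auto
      have "dist x z \<le> u + diameter (C i)" if z: "z \<in> C i" for z
      proof -
        have "dist x z - diameter (C i) \<le> dist x w" if w: "w \<in> C i" for w
        proof -
          have "dist w z \<le> diameter (C i)"
            using C z w by (intro diameter_bounded_bound) auto
          then show ?thesis
            using dist_triangle[of x z w] by simp
        qed
        then have "dist x z - diameter (C i) \<le> u"
          unfolding u_def using False by (intro cInf_greatest) auto
        then show ?thesis by simp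
      qed
      then have "dist x ` C i \<subseteq> {u..u + diameter (C i)}"
        using bdd by (auto simp: u_def intro!: cInf_lower)
      then show ?thesis
        using C by (intro exI[of _ "{u..u + diameter (C i)}"]) (auto simp: diameter_ge_0)
    qed auto
    then obtain J where J: "\<And>i. dist x ` C i \<subseteq> J i" "\<And>i. J i \<in> sets borel"
        "\<And>i. emeasure lborel (J i) \<le> ennreal (diameter (C i))"
      by metis
    have "connected (dist x ` A)"
      by (intro connected_continuous_image conn continuous_intros)
    then have "{dist x x..dist x y} \<subseteq> dist x ` A"
      using assms by (intro connected_contains_Icc) auto
    also have "\<dots> \<subseteq> (\<Union>i. J i)"
      using cov J(1) by blast
    finally have "emeasure lborel {0..dist x y} \<le> emeasure lborel (\<Union>i. J i)"
      using J(2) by (intro emeasure_mono) auto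
    also have "\<dots> \<le> (\<Sum>i. emeasure lborel (J i))"
      using J(2) by (intro emeasure_subadditive_countably) auto
    also have "\<dots> \<le> (\<Sum>i. ennreal (diameter (C i)))"
      by (intro suminf_le J) auto
    finally show ?thesis by simp
  qed
  then have "ennreal (dist x y) \<le> hausdorff1_pre 1 A"
    unfolding hausdorff1_pre_def by (intro INF_greatest) auto
  also have "\<dots> \<le> hausdorff1_outer A"
    by (rule hausdorff1_pre_le_outer) simp
  finally show ?thesis .
qed

text \<open>
  Cutting the parameter interval into sufficiently many equal pieces gives a cover by sets of arbitrarily
  small diameter, whose diameters always sum to at most \<open>B * l\<close>.
\<close>

lemma hausdorff1_outer_lipschitz_image_le:
  fixes f :: "real \<Rightarrow> 'a::metric_space"
  assumes lip: "\<And>s t. s \<in> {0..l} \<Longrightarrow> t \<in> {0..l} \<Longrightarrow> dist (f s) (f t) \<le> B * \<bar>s - t\<bar>"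
    and "0 < l" "0 \<le> B"
  shows "hausdorff1_outer (f ` {0..l}) \<le> ennreal (B * l)"
  unfolding hausdorff1_outer_def
proof (rule SUP_least)
  fix \<delta> :: real assume "\<delta> \<in> {0<..}"
  then have \<delta>: "\<delta> > 0" by simp
  obtain n where n: "real n > B * l / \<delta>" "n > 0"
    using reals_Archimedean2[of "max 0 (B * l / \<delta>)"] by (auto simp: max_def split: if_splits)
  define C where "C i = (if i < n then f ` {real i * l / n..real (Suc i) * l / n} else {})" for i
  have piece: "bounded (C i) \<and> diameter (C i) \<le> (if i < n then B * l / n else 0)" for i
  proof (cases "i < n")
    case True
    have "x \<in> {0..l}" if "x \<in> {real i * l / n..real (Suc i) * l / n}" for x
    proof -
      have "real (Suc i) * l / n \<le> l"
        using True \<open>0 < l\<close> n by (simp add: field_simps del: of_nat_Suc)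
      then show ?thesis using that \<open>0 < l\<close> by (auto intro: order_trans[rotated])
    qed
    then have d: "dist (f s) (f t) \<le> B * l / n"
      if "s \<in> {real i * l / n..real (Suc i) * l / n}" "t \<in> {real i * l / n..real (Suc i) * l / n}" for s t
    proof -
      have "\<bar>s - t\<bar> \<le> real (Suc i) * l / n - real i * l / n"
        using that by auto
      also have "\<dots> = l / n"
        using n by (simp add: add_divide_distrib[symmetric] field_simps)
      finally have "B * \<bar>s - t\<bar> \<le> B * (l / n)"
        using \<open>0 \<le> B\<close> by (rule mult_left_mono)
      then show ?thesis
        using lip[of s t] that \<open>\<And>x. x \<in> _ \<Longrightarrow> x \<in> {0..l}\<close> by fastforce
    qed
    have "bounded (C i)"
      unfolding bounded_def using True d
      by (intro exI[of _ "f (real i * l / n)"] exI[of _ "B * l / n"])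
         (use \<open>0 < l\<close> n in \<open>auto simp: C_def divide_right_mono\<close>)
    moreover have "diameter (C i) \<le> B * l / n"
      unfolding diameter_def using True d assms by (auto simp: C_def intro!: cSUP_least)
    ultimately show ?thesis using True by simp
  qed (simp add: C_def)
  have cov: "f ` {0..l} \<subseteq> (\<Union>i. C i)"
  proof clarify
    fix s assume s: "s \<in> {0..l}"
    show "f s \<in> (\<Union>i. C i)"
      \<comment> \<open>The right endpoint belongs to the last piece, not to the one given by rounding down.\<close>
    proof (cases "s = l")
      case True
      then have "f s \<in> C (n - 1)"
        using n \<open>0 < l\<close> by (auto simp: C_def of_nat_diff field_simps intro!: imageI)
      then show ?thesis by blast
    next
      case False
      define i where "i = nat \<lfloor>s * n / l\<rfloor>"
      have nonneg: "0 \<le> s * n / l" using s n by simp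
      have i: "real i \<le> s * n / l" "s * n / l < real i + 1"
        using nonneg by (auto simp: i_def)
      have "s * n / l < n"
        using s False n \<open>0 < l\<close> by (simp add: field_simps)
      then have "i < n" using i by linarith
      moreover have "s \<in> {real i * l / n..real (Suc i) * l / n}"
        using i n \<open>0 < l\<close> by (auto simp: field_simps)
      ultimately have "f s \<in> C i" by (auto simp: C_def)
      then show ?thesis by blast
    qed
  qed
  have "B * l / n \<le> \<delta>"
    using n \<delta> by (simp add: field_simps)
  then have "diameter (C i) \<le> \<delta>" for i
    using piece[of i] \<delta> by (auto split: if_splits)
  then have "hausdorff1_pre \<delta> (f ` {0..l}) \<le> (\<Sum>i. ennreal (diameter (C i)))"
    using cov piece by (intro hausdorff1_pre_le) auto
  also have "\<dots> = (\<Sum>i<n. ennreal (diameter (C i)))"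
    by (rule suminf_finite) (auto simp: C_def)
  also have "\<dots> \<le> (\<Sum>i<n. ennreal (B * l / n))"
    using piece by (intro sum_mono ennreal_leI) (metis lessThan_iff)
  also have "\<dots> = ennreal (B * l)"
    using n assms by (simp add: ennreal_of_nat_eq_real_of_nat flip: ennreal_mult'')
  finally show "hausdorff1_pre \<delta> (f ` {0..l}) \<le> ennreal (B * l)" .
qed

lemma hausdorff1_singleton: "emeasure hausdorff1 {x::'a::metric_space} = 0"
proof -
  have "hausdorff1_outer ((\<lambda>_::real. x) ` {0..1}) \<le> ennreal (0 * 1)"
    by (rule hausdorff1_outer_lipschitz_image_le) auto
  moreover have "(\<lambda>_::real. x) ` {0..1} = {x}" by (simp add: image_constant_conv)
  ultimately show ?thesis by (simp add: emeasure_hausdorff1)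
qed

section \<open>The mass of arcs of a closed curve\<close>

text \<open>
  Only a topological parametrization is required: the boundary of a convex set comes as a homeomorphic
  image of the circle, and its arc length is measured by the Hausdorff measure itself, so that no
  rectifiable or arc-length parametrization has to be constructed.
\<close>

locale parametrized_loop =
  fixes p :: "real \<Rightarrow> 'a::metric_space"
  assumes cont: "continuous_on {0..2*pi} p"
    and closed: "p (2*pi) = p 0"
    and inj: "inj_on p {0..<2*pi}"
begin

lemma compact_arc: "0 \<le> a \<Longrightarrow> b \<le> 2*pi \<Longrightarrow> compact (p ` {a..b})"
  by (intro compact_continuous_image continuous_on_subset[OF cont]) auto

lemma arc_sets: "0 \<le> a \<Longrightarrow> b \<le> 2*pi \<Longrightarrow> p ` {a..b} \<in> sets borel"
  by (simp add: compact_arc borel_compact)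

lemma connected_arc: "0 \<le> a \<Longrightarrow> b \<le> 2*pi \<Longrightarrow> connected (p ` {a..b})"
  by (intro connected_continuous_image continuous_on_subset[OF cont]) auto

lemma image_half_open: "p ` {0..2*pi} = p ` {0..<2*pi}"
proof -
  have "{0..2*pi} = insert (2*pi) {0..<2*pi}" by auto
  then show ?thesis using closed by (auto intro: image_eqI[of _ _ 0])
qed

text \<open>
  Pulling the Hausdorff measure back to the parameter interval gives a finite Borel measure on the reals.
  It has no atoms, because points have Hausdorff measure zero; hence its distribution function \<open>F\<close> is
  continuous, which makes the intermediate value theorem available for cutting the curve into arcs of
  prescribed mass. The mass bound is stated for closed arcs, which are compact and whose endpoints
  carry no mass.
\<close>

lemma arc_mass_function:
  assumes fin: "emeasure hausdorff1 (p ` {0..2*pi}) < \<infinity>"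
  obtains F where "continuous_on UNIV F" "F 0 = (0::real)"
    "F (2*pi) = measure hausdorff1 (p ` {0..2*pi})"
    "\<And>a b. 0 \<le> a \<Longrightarrow> a \<le> b \<Longrightarrow> b \<le> 2*pi \<Longrightarrow> measure hausdorff1 (p ` {a..b}) \<le> F b - F a"
proof -
  define \<Gamma> where "\<Gamma> = p ` {0..2*pi}"
  define q where "q = the_inv_into {0..<2*pi} p"
  have qp: "q (p t) = t" if "t \<in> {0..<2*pi}" for t
    unfolding q_def using inj that by (rule the_inv_into_f_f)
  have \<Gamma>: "\<Gamma> = p ` {0..<2*pi}" by (simp add: \<Gamma>_def image_half_open)
  have \<Gamma>b: "\<Gamma> \<in> sets borel" unfolding \<Gamma>_def by (rule arc_sets) auto
  define M where "M = restrict_space hausdorff1 \<Gamma>"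
  have spM: "space M = \<Gamma>" by (simp add: M_def space_restrict_space)
  have setsM: "A \<in> sets M \<longleftrightarrow> A \<subseteq> \<Gamma> \<and> A \<in> sets borel" for A
    unfolding M_def using \<Gamma>b by (subst sets_restrict_space_iff) auto
  have emM: "emeasure M A = emeasure hausdorff1 A" if "A \<subseteq> \<Gamma>" for A
    unfolding M_def using \<Gamma>b that by (subst emeasure_restrict_space) auto
  have qm: "q \<in> borel_measurable M"
  proof (rule borel_measurableI_le)
    fix t :: real
    have "{x \<in> \<Gamma>. q x \<le> t} \<in> sets borel"
    proof (cases "t < 2*pi")
      case True
      then have "{x \<in> \<Gamma>. q x \<le> t} = p ` {0..t}"
        unfolding \<Gamma> using qp by force
      then show ?thesis using True by (simp add: arc_sets)
    next
      case False
      then have "{x \<in> \<Gamma>. q x \<le> t} = \<Gamma>"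
        unfolding \<Gamma> using qp by force
      then show ?thesis using \<Gamma>b by simp
    qed
    then show "{x \<in> space M. q x \<le> t} \<in> sets M"
      by (simp add: spM setsM)
  qed
  define \<nu> where "\<nu> = distr M borel q"
  have em\<nu>: "emeasure \<nu> A = emeasure hausdorff1 (q -` A \<inter> \<Gamma>)" if "A \<in> sets borel" for A
    unfolding \<nu>_def using qm that by (subst emeasure_distr) (auto simp: spM emM)
  have me\<nu>: "measure \<nu> A = measure hausdorff1 (q -` A \<inter> \<Gamma>)" if "A \<in> sets borel" for A
    using em\<nu>[OF that] by (simp add: measure_def)
  interpret \<nu>: finite_borel_measure \<nu>
  proof (intro finite_borel_measure.intro finite_borel_measure_axioms.intro finite_measureI)
    have "emeasure \<nu> UNIV = emeasure hausdorff1 \<Gamma>" by (subst em\<nu>) auto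
    then show "emeasure \<nu> (space \<nu>) \<noteq> \<infinity>" using fin by (auto simp: \<nu>_def \<Gamma>_def)
  qed (simp add: \<nu>_def)
  have atom: "measure \<nu> {x} = 0" for x
  proof -
    have "q -` {x} \<inter> \<Gamma> \<subseteq> {p x}" unfolding \<Gamma> using qp by force
    then have "emeasure hausdorff1 (q -` {x} \<inter> \<Gamma>) \<le> emeasure hausdorff1 {p x}"
      by (intro emeasure_mono) auto
    then show ?thesis
      by (subst me\<nu>) (auto simp: hausdorff1_singleton measure_def)
  qed
  have finle: "emeasure hausdorff1 A < \<infinity>" if "A \<subseteq> \<Gamma>" for A
    using fin emeasure_mono[OF that, of hausdorff1] \<Gamma>b by (auto simp: \<Gamma>_def)
  show ?thesis
  proof
    show "continuous_on UNIV (cdf \<nu>)"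
      by (simp add: continuous_on_eq_continuous_at \<nu>.isCont_cdf atom)
    have "q -` {..0} \<inter> \<Gamma> = q -` {0} \<inter> \<Gamma>" unfolding \<Gamma> using qp by auto
    then show "cdf \<nu> 0 = 0"
      using atom[of 0] by (simp add: cdf_def me\<nu>)
    have "q -` {..2*pi} \<inter> \<Gamma> = \<Gamma>" unfolding \<Gamma> using qp by auto
    then show "cdf \<nu> (2*pi) = measure hausdorff1 (p ` {0..2*pi})"
      by (simp add: cdf_def me\<nu> \<Gamma>_def)
    fix a b :: real assume ab: "0 \<le> a" "a \<le> b" "b \<le> 2*pi"
    show "measure hausdorff1 (p ` {a..b}) \<le> cdf \<nu> b - cdf \<nu> a"
    proof (cases "a = b")
      case True
      then show ?thesis by (simp add: measure_def hausdorff1_singleton)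
    next
      case False
      define G where "G = q -` {a<..b} \<inter> \<Gamma>"
      have Gs: "G \<in> sets borel"
        using measurable_sets[OF qm, of "{a<..b}"] by (simp add: G_def spM setsM)
      have "p t \<in> G \<union> {p a, p b}" if "t \<in> {a..b}" for t
      proof (cases "t = a \<or> t = b")
        case False
        then have "t \<in> {0..<2*pi}" "t \<in> {a<..b}" using that ab by auto
        then show ?thesis using qp[of t] by (auto simp: G_def \<Gamma>)
      qed auto
      then have sub: "p ` {a..b} \<subseteq> G \<union> {p a, p b}" by blast
      have Gfin: "emeasure hausdorff1 G < \<infinity>" by (rule finle) (auto simp: G_def)
      have "emeasure hausdorff1 (p ` {a..b}) \<le> emeasure hausdorff1 (G \<union> {p a, p b})"
        using Gs sub by (intro emeasure_mono) auto
      also have "\<dots> \<le> emeasure hausdorff1 G + emeasure hausdorff1 {p a, p b}"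
        using Gs by (intro emeasure_subadditive) auto
      also have "emeasure hausdorff1 {p a, p b} \<le> emeasure hausdorff1 {p a} + emeasure hausdorff1 {p b}"
        using emeasure_subadditive[of "{p a}" hausdorff1 "{p b}"] by (simp add: insert_commute)
      finally have "emeasure hausdorff1 (p ` {a..b}) \<le> emeasure hausdorff1 G"
        by (simp add: hausdorff1_singleton)
      then have "measure hausdorff1 (p ` {a..b}) \<le> measure hausdorff1 G"
        unfolding measure_def using Gfin by (intro enn2real_mono) auto
      also have "\<dots> = cdf \<nu> b - cdf \<nu> a"
        using \<nu>.cdf_diff_eq[of a b] ab False by (simp add: me\<nu> G_def)
      finally show ?thesis .
    qed
  qed
qed

text \<open>
  Arcs are connected, so this is the bound for connected sets; it replaces the statement that an
  arc-length parametrization is 1-Lipschitz.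
\<close>

lemma chord_le_arc:
  assumes fin: "emeasure hausdorff1 (p ` {0..2*pi}) < \<infinity>"
    and ab: "0 \<le> a" "b \<le> 2*pi" and st: "s \<in> {a..b}" "t \<in> {a..b}"
  shows "dist (p s) (p t) \<le> measure hausdorff1 (p ` {a..b})"
proof -
  have "emeasure hausdorff1 (p ` {a..b}) \<le> emeasure hausdorff1 (p ` {0..2*pi})"
    using ab arc_sets[of 0 "2*pi"] by (intro emeasure_mono) auto
  then have f: "emeasure hausdorff1 (p ` {a..b}) < \<infinity>" using fin by simp
  have "ennreal (dist (p s) (p t)) \<le> emeasure hausdorff1 (p ` {a..b})"
    using ab st connected_arc[of a b]
    by (subst emeasure_hausdorff1) (auto intro!: arc_sets dist_le_hausdorff1_outer_connected)
  then show ?thesis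
    using f enn2real_mono[of "ennreal (dist (p s) (p t))"] by (simp add: measure_def)
qed

end

context parametrized_loop
begin

lemma sum_chords_le:
  assumes fin: "emeasure hausdorff1 (p ` {0..2*pi}) < \<infinity>"
    and t0: "0 \<le> t 0" and tn: "t n \<le> 2*pi" and mono: "\<And>k. k < n \<Longrightarrow> t k \<le> t (Suc k)"
  shows "(\<Sum>k<n. dist (p (t k)) (p (t (Suc k)))) \<le> measure hausdorff1 (p ` {0..2*pi})"
proof -
  obtain F where F: "F 0 = (0::real)" "F (2*pi) = measure hausdorff1 (p ` {0..2*pi})"
    "\<And>a b. 0 \<le> a \<Longrightarrow> a \<le> b \<Longrightarrow> b \<le> 2*pi \<Longrightarrow> measure hausdorff1 (p ` {a..b}) \<le> F b - F a"
    using arc_mass_function[OF fin] by metis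
  have mono': "t i \<le> t j" if "i \<le> j" "j \<le> n" for i j
    using that
  proof (induction j rule: dec_induct)
    case (step j)
    then show ?case using mono[of j] by simp
  qed simp
  have range: "0 \<le> t k" "t k \<le> 2*pi" if "k \<le> n" for k
    using mono'[of 0 k] mono'[of k n] that t0 tn by auto
  have Fmono: "F a \<le> F b" if "0 \<le> a" "a \<le> b" "b \<le> 2*pi" for a b
    using F(3)[OF that] measure_nonneg[of hausdorff1 "p ` {a..b}"] by linarith
  have "(\<Sum>k<n. dist (p (t k)) (p (t (Suc k)))) \<le> (\<Sum>k<n. F (t (Suc k)) - F (t k))"
  proof (rule sum_mono)
    fix k assume "k \<in> {..<n}"
    then have k: "k < n" by simp
    then have r: "0 \<le> t k" "t k \<le> t (Suc k)" "t (Suc k) \<le> 2*pi"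
      using range[of k] range[of "Suc k"] mono by auto
    show "dist (p (t k)) (p (t (Suc k))) \<le> F (t (Suc k)) - F (t k)"
      using chord_le_arc[OF fin, of "t k" "t (Suc k)"] F(3)[of "t k" "t (Suc k)"] r by fastforce
  qed
  also have "\<dots> = F (t n) - F (t 0)"
    by (rule sum_lessThan_telescope)
  also have "\<dots> \<le> F (2*pi) - F 0"
    using Fmono[of "t n" "2*pi"] Fmono[of 0 "t 0"] range[of 0] range[of n] by auto
  finally show ?thesis by (simp add: F)
qed

text \<open>
  This is the discrete form of an arc-length parametrization: by the chord bound, the points \<open>p (t k)\<close>
  are the vertices of a closed \<open>n\<close>-gon all of whose sides have length at most \<open>L / n\<close>.
\<close>

lemma equal_mass_partition:
  assumes fin: "emeasure hausdorff1 (p ` {0..2*pi}) < \<infinity>"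
    and L: "L = measure hausdorff1 (p ` {0..2*pi})" "L > 0" and n: "n > 0"
  obtains t :: "nat \<Rightarrow> real" where "t 0 = 0" "t n = 2*pi"
    "\<And>k. k < n \<Longrightarrow> 0 \<le> t k \<and> t k \<le> t (Suc k) \<and> t (Suc k) \<le> 2*pi"
    "\<And>k. k < n \<Longrightarrow> measure hausdorff1 (p ` {t k..t (Suc k)}) \<le> L / n"
proof -
  obtain F where F: "continuous_on UNIV F" "F 0 = (0::real)" "F (2*pi) = L"
    "\<And>a b. 0 \<le> a \<Longrightarrow> a \<le> b \<Longrightarrow> b \<le> 2*pi \<Longrightarrow> measure hausdorff1 (p ` {a..b}) \<le> F b - F a"
    using arc_mass_function[OF fin] L by metis
  have Fmono: "F a \<le> F b" if "0 \<le> a" "a \<le> b" "b \<le> 2*pi" for a b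
    using F(4)[OF that] measure_nonneg[of hausdorff1 "p ` {a..b}"] by linarith
  \<comment> \<open>The first and the last point have to be ends of the parameter interval; the intermediate value theorem
    gives only a point with the right value of \<open>F\<close>, so these two are chosen by hand.\<close>
  have "\<exists>s. 0 \<le> s \<and> s \<le> 2*pi \<and> F s = k * L / n \<and> (k = 0 \<longrightarrow> s = 0) \<and> (k = n \<longrightarrow> s = 2*pi)"
    if "k \<le> n" for k
  proof -
    consider "k = 0" | "k = n" | "k \<noteq> 0" "k \<noteq> n" by blast
    then show ?thesis
    proof cases
      case 1 then show ?thesis using F n by (intro exI[of _ 0]) auto
    next
      case 2 then show ?thesis using F n by (intro exI[of _ "2*pi"]) auto
    next
      case 3
      have "\<exists>s\<ge>0. s \<le> 2*pi \<and> F s = k * L / n"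
      proof (rule IVT')
        show "F 0 \<le> k * L / n" using F L by simp
        show "k * L / n \<le> F (2*pi)" using F L that n by (simp add: divide_le_eq mult.commute)
        show "continuous_on {0..2*pi} F" using F(1) continuous_on_subset by blast
      qed auto
      then show ?thesis using 3 by blast
    qed
  qed
  then obtain t where t: "\<And>k. k \<le> n \<Longrightarrow> 0 \<le> t k \<and> t k \<le> 2*pi \<and> F (t k) = k * L / n
      \<and> (k = 0 \<longrightarrow> t k = 0) \<and> (k = n \<longrightarrow> t k = 2*pi)"
    by metis
  have step: "0 \<le> t k \<and> t k \<le> t (Suc k) \<and> t (Suc k) \<le> 2*pi" if k: "k < n" for k
  proof -
    have "\<not> t (Suc k) < t k"
    proof
      assume "t (Suc k) < t k"
      then have "F (t (Suc k)) \<le> F (t k)"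
        using t[of k] t[of "Suc k"] k by (intro Fmono) auto
      then have "(real k + 1) * L / n \<le> k * L / n"
        using t[of k] t[of "Suc k"] k by (simp add: add.commute)
      then have "L \<le> 0" using n by (simp add: field_simps mult_le_0_iff)
      then show False using L(2) by simp
    qed
    then show ?thesis using t[of k] t[of "Suc k"] k by auto
  qed
  show ?thesis
  proof (rule that[of t])
    fix k assume k: "k < n"
    then have "measure hausdorff1 (p ` {t k..t (Suc k)}) \<le> F (t (Suc k)) - F (t k)"
      using step[OF k] by (intro F(4)) auto
    also have "\<dots> = L / n"
      using t[of k] t[of "Suc k"] k n by (simp add: field_simps)
    finally show "measure hausdorff1 (p ` {t k..t (Suc k)}) \<le> L / n" .
  qed (use t[of 0] t[of n] step in auto)
qed

end

section \<open>Circles and convex boundaries in the plane\<close>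

text \<open>
  Fourier coefficients are complex numbers, whereas the sets live in \<^typ>\<open>real^2\<close>; these two inverse
  isometries mediate between the two models of the plane.
\<close>

definition plane_of_complex :: "complex \<Rightarrow> real^2" where
  "plane_of_complex z = vector [Re z, Im z]"

definition complex_of_plane :: "real^2 \<Rightarrow> complex" where
  "complex_of_plane v = Complex (v $ 1) (v $ 2)"

lemma plane_of_complex_inverse [simp]: "complex_of_plane (plane_of_complex z) = z"
  by (simp add: complex_of_plane_def plane_of_complex_def)

lemma complex_of_plane_inverse [simp]: "plane_of_complex (complex_of_plane v) = v"
  by (simp add: complex_of_plane_def plane_of_complex_def vec_eq_iff forall_2)

lemma plane_of_complex_diff: "plane_of_complex (z - w) = plane_of_complex z - plane_of_complex w"
  and plane_of_complex_scaleR: "plane_of_complex (c *\<^sub>R z) = c *\<^sub>R plane_of_complex z"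
  by (simp_all add: plane_of_complex_def vec_eq_iff forall_2)

lemma norm_plane_of_complex [simp]: "norm (plane_of_complex z) = norm z"
  by (simp add: plane_of_complex_def norm_vec_def L2_set_def sum_2 cmod_def)

lemma norm_complex_of_plane [simp]: "norm (complex_of_plane v) = norm v"
  by (metis complex_of_plane_inverse norm_plane_of_complex)

lemma complex_of_plane_diff: "complex_of_plane (v - w) = complex_of_plane v - complex_of_plane w"
  by (simp add: complex_of_plane_def complex_eq_iff)

lemma norm_cis_diff: "norm (cis s - cis t) = 2 * \<bar>sin ((s - t) / 2)\<bar>"
proof (rule power2_eq_imp_eq)
  have "(norm (cis s - cis t))\<^sup>2 = (cos s - cos t)\<^sup>2 + (sin s - sin t)\<^sup>2"
    by (simp add: cmod_def)
  also have "\<dots> = ((cos s)\<^sup>2 + (sin s)\<^sup>2) + ((cos t)\<^sup>2 + (sin t)\<^sup>2) - 2 * cos (s - t)"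
    by (simp add: cos_diff power2_eq_square algebra_simps)
  also have "\<dots> = 2 - 2 * cos (2 * ((s - t) / 2))"
    by simp (metis nonzero_mult_div_cancel_left right_diff_distrib' zero_neq_numeral)
  also have "\<dots> = (2 * \<bar>sin ((s - t) / 2)\<bar>)\<^sup>2"
    unfolding cos_double_sin by (simp add: power_mult_distrib)
  finally show "(norm (cis s - cis t))\<^sup>2 = (2 * \<bar>sin ((s - t) / 2)\<bar>)\<^sup>2" .
qed auto

lemma norm_cis_diff_le: "norm (cis s - cis t) \<le> \<bar>s - t\<bar>"
  unfolding norm_cis_diff using abs_sin_le_one abs_sin_x_le_abs_x[of "(s - t) / 2"] by simp

lemma inj_on_cis: "inj_on cis {0..<2*pi}"
proof (rule inj_on_inverseI)
  fix t assume "t \<in> {0..<2*pi}"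
  then show "Arg2pi (cis t) = t"
    by (intro Arg2pi_unique[of 1]) (auto simp: cis_conv_exp)
qed

lemma cis_image_sphere: "cis ` {0..2*pi} = sphere 0 1"
proof
  show "sphere 0 1 \<subseteq> cis ` {0..2*pi}"
  proof
    fix z :: complex assume "z \<in> sphere 0 1"
    then have "z = cis (Arg2pi z)"
      using Arg2pi_eq[of z] by (simp add: cis_conv_exp)
    moreover have "Arg2pi z \<in> {0..2*pi}"
      using Arg2pi_ge_0[of z] Arg2pi_lt_2pi[of z] by simp
    ultimately show "z \<in> cis ` {0..2*pi}" by blast
  qed
qed auto

definition circle_point :: "real^2 \<Rightarrow> real \<Rightarrow> real \<Rightarrow> real^2" where
  "circle_point c r t = c + r *\<^sub>R plane_of_complex (cis t)"

lemma dist_circle_point: "0 \<le> r \<Longrightarrow> dist (circle_point c r s) (circle_point c r t) = r * norm (cis s - cis t)"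
  by (simp add: circle_point_def dist_norm norm_plane_of_complex
      flip: scaleR_diff_right plane_of_complex_diff)

lemma circle_point_image: "0 < r \<Longrightarrow> circle_point c r ` {0..2*pi} = sphere c r"
proof -
  assume r: "0 < r"
  have "x \<in> circle_point c r ` {0..2*pi}" if "x \<in> sphere c r" for x
  proof -
    have "complex_of_plane ((1/r) *\<^sub>R (x - c)) \<in> sphere 0 1"
      using that r by (simp add: dist_norm norm_minus_commute)
    then obtain t where "t \<in> {0..2*pi}" "complex_of_plane ((1/r) *\<^sub>R (x - c)) = cis t"
      unfolding cis_image_sphere[symmetric] by blast
    then have "x = circle_point c r t"
      using r by (simp add: circle_point_def flip: \<open>_ = cis t\<close>)
    then show ?thesis using \<open>t \<in> _\<close> by blast
  qed
  then show ?thesis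
    using r by (auto simp: circle_point_def dist_norm)
qed

lemma parametrized_loop_circle:
  assumes r: "0 < r"
  shows "parametrized_loop (circle_point c r)"
proof
  show "continuous_on {0..2*pi} (circle_point c r)"
    unfolding continuous_on_iff
  proof (intro ballI allI impI)
    fix s e :: real assume e: "e > 0"
    have "dist (circle_point c r t) (circle_point c r s) < e" if "dist t s < e / r" for t
    proof -
      have "dist (circle_point c r t) (circle_point c r s) \<le> r * \<bar>t - s\<bar>"
        using r by (simp add: dist_circle_point norm_cis_diff_le)
      also have "\<dots> < e" using that r by (simp add: dist_real_def field_simps)
      finally show ?thesis .
    qed
    then show "\<exists>d>0. \<forall>t\<in>{0..2*pi}. dist t s < d \<longrightarrow> dist (circle_point c r t) (circle_point c r s) < e"
      using e r by (intro exI[of _ "e / r"]) auto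
  qed
  show "circle_point c r (2*pi) = circle_point c r 0"
    by (simp add: circle_point_def)
  show "inj_on (circle_point c r) {0..<2*pi}"
  proof (rule inj_onI)
    fix s t assume "s \<in> {0..<2*pi}" "t \<in> {0..<2*pi}" "circle_point c r s = circle_point c r t"
    moreover from this have "cis s = cis t"
      using dist_circle_point[of r c s t] r by auto
    ultimately show "s = t" using inj_on_cis by (auto dest: inj_onD)
  qed
qed

lemma hausdorff1_sphere_le:
  assumes "0 < r"
  shows "emeasure hausdorff1 (sphere c r :: (real^2) set) \<le> ennreal (2 * pi * r)"
proof -
  have "hausdorff1_outer (circle_point c r ` {0..2*pi}) \<le> ennreal (r * (2*pi))"
    using assms by (intro hausdorff1_outer_lipschitz_image_le)
      (auto simp: dist_circle_point intro!: mult_left_mono norm_cis_diff_le)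
  then show ?thesis
    using assms by (simp add: circle_point_image emeasure_hausdorff1 mult.commute[of r])
qed

text \<open>
  The upper bound comes from the Lipschitz parametrization, the lower bound from the chords of inscribed
  regular \<open>n\<close>-gons, whose total length \<open>2 * n * r * sin (pi / n)\<close> tends to \<open>2 * pi * r\<close>.
\<close>

lemma perimeter_ball:
  assumes r: "0 < r"
  shows "perimeter (ball c r) = 2 * pi * r"
proof (rule antisym)
  have fin: "emeasure hausdorff1 (sphere c r) < \<infinity>"
    using hausdorff1_sphere_le[OF r, of c] by (simp add: order.strict_trans1)
  have fr: "frontier (ball c r) = sphere c r"
    using r by (simp add: frontier_ball)
  have "measure hausdorff1 (sphere c r) \<le> enn2real (ennreal (2 * pi * r))"
    unfolding measure_def by (intro enn2real_mono hausdorff1_sphere_le r) auto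
  then show "perimeter (ball c r) \<le> 2 * pi * r"
    using r by (simp add: perimeter_def fr)
  interpret parametrized_loop "circle_point c r"
    by (rule parametrized_loop_circle[OF r])
  have "2 * pi * r * (sin (pi / real n) / (pi / real n)) \<le> measure hausdorff1 (sphere c r)" if n: "n > 0" for n
  proof -
    define t where "t k = 2 * pi * real k / real n" for k
    have d: "dist (circle_point c r (t k)) (circle_point c r (t (Suc k))) = r * (2 * sin (pi / n))" for k
    proof -
      have "(t k - t (Suc k)) / 2 = - (pi / n)"
        using n by (simp add: t_def field_simps)
      moreover have "0 \<le> sin (pi / n)"
        using n by (intro sin_ge_zero) (auto simp: field_simps)
      ultimately show ?thesis
        using r by (simp add: dist_circle_point norm_cis_diff)
    qed
    have "(\<Sum>k<n. dist (circle_point c r (t k)) (circle_point c r (t (Suc k))))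
        \<le> measure hausdorff1 (circle_point c r ` {0..2*pi})"
      using fin n r
      by (intro sum_chords_le) (auto simp: circle_point_image t_def divide_right_mono)
    then have "real n * (r * (2 * sin (pi / n))) \<le> measure hausdorff1 (sphere c r)"
      using r by (simp add: d circle_point_image)
    also have "real n * (r * (2 * sin (pi / n))) = 2 * pi * r * (sin (pi / real n) / (pi / real n))"
      using n by (simp add: field_simps)
    finally show ?thesis .
  qed
  moreover have "(\<lambda>n. 2 * pi * r * (sin (pi / real n) / (pi / real n))) \<longlonglongrightarrow> 2 * pi * r * 1"
    by (intro tendsto_intros) real_asymp
  ultimately show "2 * pi * r \<le> perimeter (ball c r)"
    by (intro LIMSEQ_le_const2[of _ "2 * pi * r * 1", simplified])
       (auto simp: perimeter_def fr intro!: exI[of _ 1])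
qed

lemma frontier_convex_parametrization:
  fixes E :: "(real^2) set"
  assumes E: "E \<noteq> {}" "open E" "bounded E" "convex E"
  obtains p where "parametrized_loop p" "p ` {0..2*pi} = frontier E"
proof -
  have "rel_frontier E = frontier E"
    using E by (intro rel_frontier_nonempty_interior) (simp add: interior_open)
  moreover have "interior (ball (0::complex) 1) \<noteq> {}"
    by simp
  then have "rel_frontier (ball (0::complex) 1) = sphere 0 1"
    by (simp add: rel_frontier_nonempty_interior frontier_ball)
  moreover have "rel_frontier (ball (0::complex) 1) homeomorphic rel_frontier E"
    using E by (intro homeomorphic_rel_frontiers_convex_bounded_sets) (auto simp: aff_dim_open)
  ultimately have "sphere (0::complex) 1 homeomorphic frontier E"
    by simp
  then obtain f g where h: "homeomorphism (sphere (0::complex) 1) (frontier E) f g"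
    unfolding homeomorphic_def by blast
  have "parametrized_loop (f \<circ> cis)"
  proof
    show "continuous_on {0..2*pi} (f \<circ> cis)"
    proof (rule continuous_on_compose)
      show "continuous_on {0..2*pi} cis"
        by (intro continuous_intros)
      show "continuous_on (cis ` {0..2*pi}) f"
        using h unfolding cis_image_sphere homeomorphism_def by blast
    qed
    show "(f \<circ> cis) (2*pi) = (f \<circ> cis) 0" by simp
    show "inj_on (f \<circ> cis) {0..<2*pi}"
    proof (rule comp_inj_on[OF inj_on_cis])
      show "inj_on f (cis ` {0..<2*pi})"
        using homeomorphism_apply1[OF h] by (intro inj_on_inverseI[of _ g]) auto
    qed
  qed
  moreover have "(f \<circ> cis) ` {0..2*pi} = frontier E"
    using homeomorphism_image1[OF h] by (simp only: image_comp[symmetric] cis_image_sphere)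
  ultimately show ?thesis by (rule that)
qed

text \<open>
  At a boundary point there is a supporting hyperplane; moving away from the set along its normal until
  the sphere is reached gives a point whose nearest point in the set is the boundary point again.
\<close>

lemma closest_point_sphere_onto_frontier:
  fixes E :: "'a::euclidean_space set"
  assumes E: "convex E" "open E" "x \<in> frontier E" and R: "closure E \<subseteq> cball 0 R"
  shows "x \<in> closest_point (closure E) ` sphere 0 R"
proof -
  have x: "x \<in> closure E" "x \<notin> rel_interior E"
    using E by (auto simp: frontier_def interior_open rel_interior_open)
  obtain a where a: "a \<noteq> 0" "\<And>y. y \<in> closure E \<Longrightarrow> a \<bullet> x \<le> a \<bullet> y"
    using supporting_hyperplane_relative_frontier[OF E(1) x] by metis
  have xR: "norm x \<le> R" using x R by auto
  define T where "T = 2 * R / norm a"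
  have T: "T \<ge> 0" using order_trans[OF norm_ge_zero xR] by (simp add: T_def)
  have "\<exists>s\<ge>0. s \<le> T \<and> norm (x - s *\<^sub>R a) = R"
  proof (rule IVT')
    show "norm (x - 0 *\<^sub>R a) \<le> R" using xR by simp
    have "norm (T *\<^sub>R a) - norm x \<le> norm (x - T *\<^sub>R a)"
      by (metis norm_minus_commute norm_triangle_ineq2)
    moreover have "norm (T *\<^sub>R a) = 2 * R"
      using a order_trans[OF norm_ge_zero xR] by (simp add: T_def)
    ultimately show "R \<le> norm (x - T *\<^sub>R a)" using xR by simp
    show "continuous_on {0..T} (\<lambda>s. norm (x - s *\<^sub>R a))"
      by (intro continuous_intros)
  qed (rule T)
  then obtain s where s: "s \<ge> 0" "norm (x - s *\<^sub>R a) = R" by blast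
  have "x = closest_point (closure E) (x - s *\<^sub>R a)"
  proof (rule closest_point_unique)
    show "\<forall>z\<in>closure E. dist (x - s *\<^sub>R a) x \<le> dist (x - s *\<^sub>R a) z"
    proof
      fix z assume z: "z \<in> closure E"
      have "0 \<le> s * (a \<bullet> (z - x))"
        using a(2)[OF z] s by (simp add: inner_diff_right)
      moreover have "(norm (x - s *\<^sub>R a - z))\<^sup>2
          = (norm (s *\<^sub>R a))\<^sup>2 + (norm (z - x))\<^sup>2 + 2 * (s * (a \<bullet> (z - x)))"
        unfolding power2_norm_eq_inner by (simp add: inner_simps inner_commute algebra_simps)
      ultimately have "(norm (s *\<^sub>R a))\<^sup>2 \<le> (norm (x - s *\<^sub>R a - z))\<^sup>2" by simp
      then have "norm (s *\<^sub>R a) \<le> norm (x - s *\<^sub>R a - z)"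
        by (rule power2_le_imp_le) simp
      then show "dist (x - s *\<^sub>R a) x \<le> dist (x - s *\<^sub>R a) z"
        by (simp add: dist_norm)
    qed
  qed (use E x in \<open>auto intro: convex_closure\<close>)
  then show ?thesis using s by (intro image_eqI) auto
qed

text \<open>
  The nearest-point map is 1-Lipschitz and maps a large circle onto the boundary, so the boundary is a
  Lipschitz curve.
\<close>

lemma hausdorff1_frontier_convex_finite:
  fixes E :: "(real^2) set"
  assumes E: "E \<noteq> {}" "open E" "bounded E" "convex E"
  shows "emeasure hausdorff1 (frontier E) < \<infinity>"
proof -
  obtain R where R: "R > 0" "closure E \<subseteq> cball 0 R"
    using bounded_closure[OF E(3)] unfolding bounded_pos by (auto simp: subset_iff)
  define f where "f t = closest_point (closure E) (circle_point 0 R t)" for t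
  have "frontier E \<subseteq> f ` {0..2*pi}"
  proof
    fix x assume "x \<in> frontier E"
    then have "x \<in> closest_point (closure E) ` circle_point 0 R ` {0..2*pi}"
      using closest_point_sphere_onto_frontier[OF E(4,2) _ R(2)] circle_point_image[OF R(1)] by simp
    then show "x \<in> f ` {0..2*pi}"
      by (simp add: f_def image_image)
  qed
  then have "hausdorff1_outer (frontier E) \<le> hausdorff1_outer (f ` {0..2*pi})"
    by (rule hausdorff1_outer_mono)
  also have "\<dots> \<le> ennreal (R * (2*pi))"
  proof (rule hausdorff1_outer_lipschitz_image_le)
    fix s t
    have "dist (f s) (f t) \<le> dist (circle_point 0 R s) (circle_point 0 R t)"
      unfolding f_def using E by (intro closest_point_lipschitz convex_closure) auto
    also have "\<dots> \<le> R * \<bar>s - t\<bar>"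
      using R by (simp add: dist_circle_point norm_cis_diff_le)
    finally show "dist (f s) (f t) \<le> R * \<bar>s - t\<bar>" .
  qed (use R in auto)
  finally show ?thesis
    by (simp add: emeasure_hausdorff1 frontier_closed borel_closed order.strict_trans1)
qed

section \<open>Discrete Fourier analysis\<close>

text \<open>
  The characters of the cyclic group of order \<open>n\<close>. Frequencies are integers, so that a curve of odd length
  \<open>n = 2 * N + 1\<close> can be expanded in the symmetric range from \<open>-N\<close> to \<open>N\<close>, where the two frequencies \<open>1\<close> and
  \<open>-1\<close> of the two orientations of the circle appear alike.
\<close>

definition mode :: "nat \<Rightarrow> int \<Rightarrow> nat \<Rightarrow> complex" where
  "mode n j k = cis (2 * pi * of_int j * real k / real n)"

lemma mode_mult: "mode n i k * mode n j k = mode n (i + j) k"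
  by (simp add: mode_def cis_mult add_divide_distrib distrib_left distrib_right)

lemma cnj_mode: "cnj (mode n j k) = mode n (- j) k"
  by (simp add: mode_def cis_cnj)

lemma norm_mode [simp]: "norm (mode n j k) = 1"
  by (simp add: mode_def)

lemma mode_Suc: "mode n j (Suc k) = mode n j k * cis (2 * pi * of_int j / real n)"
  by (simp add: mode_def cis_mult add_divide_distrib distrib_left distrib_right add.commute)

lemma mode_0_left [simp]: "mode n 0 k = 1"
  by (simp add: mode_def)

lemma mode_period: "n > 0 \<Longrightarrow> mode n j n = mode n j 0"
  by (simp add: mode_def cis_multiple_2pi)

lemma sum_mode:
  assumes "n > 0"
  shows "(\<Sum>k<n. mode n j k) = (if int n dvd j then of_nat n else 0)"
proof (cases "int n dvd j")
  case True
  then obtain m where "j = int n * m" by blast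
  then have "mode n j k = 1" for k
    using assms cis_multiple_2pi[of "of_int (m * int k)"] by (simp add: mode_def mult_ac)
  then show ?thesis using True by simp
next
  case False
  define q where "q = cis (2 * pi * of_int j / real n)"
  have mq: "mode n j k = q ^ k" for k
    unfolding mode_def q_def by (subst Complex.DeMoivre) (simp add: mult_ac)
  have "q \<noteq> 1"
  proof
    assume "q = 1"
    then have "cos (2 * pi * of_int j / real n) = 1"
      unfolding q_def by (metis cis.sel(1) one_complex.sel(1))
    then obtain m :: int where "2 * pi * of_int j / real n = of_int m * 2 * pi"
      unfolding cos_one_2pi_int by blast
    then have "real_of_int j = of_int (m * int n)"
      using assms by (simp add: field_simps)
    then have "j = m * int n" by linarith
    with False show False by simp
  qed
  moreover have "q ^ n = 1"
    using mq[of n] mode_period[OF assms, of j] by (simp add: mode_def)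
  ultimately show ?thesis
    using False by (simp add: mq geometric_sum)
qed

lemma parseval_trig_polynomial:
  assumes n: "n > 0" and J: "finite J"
    and incong: "\<And>i j. i \<in> J \<Longrightarrow> j \<in> J \<Longrightarrow> int n dvd i - j \<Longrightarrow> i = j"
  shows "(\<Sum>k<n. (norm (\<Sum>j\<in>J. b j * mode n j k))\<^sup>2) = real n * (\<Sum>j\<in>J. (norm (b j))\<^sup>2)"
proof -
  have "complex_of_real (\<Sum>k<n. (norm (\<Sum>j\<in>J. b j * mode n j k))\<^sup>2)
      = (\<Sum>k<n. (\<Sum>i\<in>J. b i * mode n i k) * cnj (\<Sum>j\<in>J. b j * mode n j k))"
    by (simp only: of_real_sum complex_norm_square)
  also have "\<dots> = (\<Sum>k<n. \<Sum>i\<in>J. \<Sum>j\<in>J. b i * cnj (b j) * mode n (i - j) k)"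
    by (simp add: sum_product cnj_mode mode_mult[of n _ _ "- _", simplified, symmetric] mult_ac)
  also have "\<dots> = (\<Sum>i\<in>J. \<Sum>j\<in>J. \<Sum>k<n. b i * cnj (b j) * mode n (i - j) k)"
    by (subst sum.swap, intro sum.cong refl, subst sum.swap) simp
  also have "\<dots> = (\<Sum>i\<in>J. \<Sum>j\<in>J. if i = j then of_nat n * (b i * cnj (b i)) else 0)"
  proof (intro sum.cong refl)
    fix i j assume "i \<in> J" "j \<in> J"
    then have "int n dvd i - j \<longleftrightarrow> i = j" using incong by auto
    then show "(\<Sum>k<n. b i * cnj (b j) * mode n (i - j) k)
        = (if i = j then of_nat n * (b i * cnj (b i)) else 0)"
      using n by (auto simp: sum_mode simp flip: sum_distrib_left)
  qed
  also have "\<dots> = complex_of_real (real n * (\<Sum>j\<in>J. (norm (b j))\<^sup>2))"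
    using J by (simp add: sum_distrib_left complex_norm_square del: of_real_power)
  finally show ?thesis
    by (simp only: of_real_eq_iff)
qed

lemma incongruent_symmetric_range:
  assumes "i \<in> {- int N..int N}" "j \<in> {- int N..int N}" "int (2 * N + 1) dvd i - j"
  shows "i = j"
proof -
  have "\<bar>i - j\<bar> < int (2 * N + 1)" using assms by auto
  then show ?thesis using assms(3) dvd_imp_le_int[of "i - j"] by fastforce
qed

lemma dft_inversion:
  fixes w :: "nat \<Rightarrow> complex"
  assumes n: "n = 2 * N + 1"
    and b: "\<And>j. b j = (\<Sum>l<n. w l * mode n (- j) l) / of_nat n"
    and k: "k < n"
  shows "w k = (\<Sum>j=- int N..int N. b j * mode n j k)"
proof -
  have n0: "n > 0" using n by simp
  have orth: "(\<Sum>j=- int N..int N. mode n (- j) l * mode n j k) = (if l = k then of_nat n else 0)"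
    if l: "l < n" for l
  proof -
    define d where "d = int k - int l"
    have "(\<Sum>j=- int N..int N. mode n (- j) l * mode n j k)
        = (\<Sum>j=- int N..int N. cis (2 * pi * of_int j * of_int d / real n))"
      unfolding mode_def cis_mult d_def
      by (intro sum.cong refl arg_cong[of _ _ cis]) (simp add: diff_divide_distrib algebra_simps)
    also have "\<dots> = (\<Sum>i<n. cis (2 * pi * of_int (int i - int N) * of_int d / real n))"
      by (rule sum.reindex_bij_witness[of _ "\<lambda>i. int i - int N" "\<lambda>j. nat (j + int N)"])
         (auto simp: n)
    also have "\<dots> = (\<Sum>i<n. cis (- 2 * pi * of_int (int N) * of_int d / real n) * mode n d i)"
      unfolding mode_def cis_mult
      by (intro sum.cong refl arg_cong[of _ _ cis]) (simp add: field_simps)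
    also have "\<dots> = cis (- 2 * pi * of_int (int N) * of_int d / real n) * (if int n dvd d then of_nat n else 0)"
      using n0 by (simp only: sum_mode flip: sum_distrib_left)
    also have "\<dots> = (if l = k then of_nat n else 0)"
    proof (cases "l = k")
      case False
      have "\<not> int n dvd d"
      proof
        assume "int n dvd d"
        moreover have "d \<noteq> 0" using False by (simp add: d_def)
        ultimately have "int n \<le> \<bar>d\<bar>" using dvd_imp_le_int[of d "int n"] by simp
        then show False using l k by (auto simp: d_def)
      qed
      then show ?thesis using False by simp
    qed (simp add: d_def)
    finally show ?thesis .
  qed
  have "(\<Sum>j=- int N..int N. b j * mode n j k)
      = (\<Sum>j=- int N..int N. \<Sum>l<n. w l * (mode n (- j) l * mode n j k) / of_nat n)"
    by (simp add: b sum_distrib_left sum_distrib_right sum_divide_distrib mult_ac)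
  also have "\<dots> = (\<Sum>l<n. \<Sum>j=- int N..int N. w l * (mode n (- j) l * mode n j k) / of_nat n)"
    by (rule sum.swap)
  also have "\<dots> = (\<Sum>l<n. w l * (if l = k then of_nat n else 0) / of_nat n)"
    by (intro sum.cong refl) (simp add: orth flip: sum_distrib_left sum_divide_distrib)
  also have "\<dots> = (\<Sum>l<n. if l = k then w l else 0)"
    using n0 by (intro sum.cong refl) auto
  also have "\<dots> = w k"
    using k by simp
  finally show ?thesis by simp
qed

lemma sum_inverse_squares_le: "(\<Sum>m=2..N. 1 / (real m)\<^sup>2) \<le> 1"
proof -
  have "(\<Sum>m=2..N. 1 / (real m)\<^sup>2) \<le> 1 - 1 / N" if "N \<ge> 1"
    using that
  proof (induction N rule: dec_induct)
    case (step m)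
    have "1 / (real (Suc m))\<^sup>2 \<le> 1 / (real m * real (Suc m))"
      using step by (intro divide_left_mono) (auto simp: power2_eq_square)
    also have "\<dots> = 1 / m - 1 / Suc m"
      using step by (simp add: field_simps)
    finally show ?case
      using step by (simp add: sum.cl_ivl_Suc)
  qed simp
  then show ?thesis by (cases "N \<ge> 1") (auto intro: order_trans)
qed

text \<open>
  The graph of the sine lies above its chord over \<open>[0, pi / 2]\<close>, by concavity.
\<close>

lemma sin_ge_two_div_pi:
  assumes "0 \<le> x" "x \<le> pi / 2"
  shows "2 * x / pi \<le> sin x"
proof -
  have "concave_on {0..pi} sin"
    by (rule f''_le0_imp_concave[where f' = cos and f'' = "\<lambda>x. - sin x"])
       (auto intro!: derivative_eq_intros sin_ge_zero)
  then have "(1 - 2 * x / pi) * sin 0 + 2 * x / pi * sin (pi / 2)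
      \<le> sin ((1 - 2 * x / pi) *\<^sub>R 0 + (2 * x / pi) *\<^sub>R (pi / 2))"
    using assms by (intro concave_onD) (auto simp: field_simps)
  then show ?thesis by simp
qed

text \<open>
  If the squares of two nonnegative numbers add up to nearly \<open>1\<close> while their product is nearly \<open>0\<close>, then one of
  them is nearly \<open>1\<close> and the other nearly \<open>0\<close>. For small \<open>e\<close> the larger number is at least \<open>1/2\<close>, so the product
  bound controls the smaller one linearly in \<open>e\<close>; for large \<open>e\<close> the trivial bounds suffice.
\<close>

lemma two_mode_estimate:
  fixes X Y e :: real
  assumes "0 \<le> Y" "Y \<le> X" "0 \<le> e" "X\<^sup>2 + Y\<^sup>2 \<le> 1" "1 - 3 * e\<^sup>2 \<le> X\<^sup>2 + Y\<^sup>2"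
    and XY: "X * Y \<le> 4 * e\<^sup>2 + 4 * e"
  shows "\<bar>X - 1\<bar> + Y + 4 * e \<le> 120 * e"
proof (cases "e \<ge> 1/3")
  case True
  have "X\<^sup>2 \<le> 1\<^sup>2" "Y\<^sup>2 \<le> 1\<^sup>2" using assms by (smt (verit) zero_le_power2 one_power2)+
  then have "X \<le> 1" "Y \<le> 1" by (auto intro: power2_le_imp_le)
  then show ?thesis using True assms by auto
next
  case False
  have e2: "e\<^sup>2 \<le> e / 3"
    using False assms mult_left_mono[of e "1/3" e] by (simp add: power2_eq_square)
  have "X\<^sup>2 \<le> 1\<^sup>2" using assms by (smt (verit) zero_le_power2 one_power2)
  then have X1: "X \<le> 1" by (auto intro: power2_le_imp_le)
  have "Y\<^sup>2 \<le> X\<^sup>2" using assms by (intro power_mono)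
  then have "1/4 \<le> X\<^sup>2" using assms e2 False by linarith
  then have "(1/2)\<^sup>2 \<le> X\<^sup>2" by (simp add: power2_eq_square[of "1/2"])
  then have "1/2 \<le> X" by (rule power2_le_imp_le) (use assms in auto)
  then have "1/2 * Y \<le> X * Y" using assms by (intro mult_right_mono)
  then have Y: "Y \<le> 11 * e" using XY e2 assms(3) by linarith
  then have "Y\<^sup>2 \<le> 121 * e\<^sup>2"
    using assms power_mono[of Y "11 * e" 2] by (simp add: power_mult_distrib)
  then have "1 - X\<^sup>2 \<le> 42 * e" using assms e2 by linarith
  moreover have "X\<^sup>2 \<le> X" using X1 assms by (simp add: power2_eq_square mult_left_le)
  ultimately show ?thesis using X1 Y assms by simp
qed

section \<open>Stability of the discrete Wirtinger inequality\<close>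

text \<open>
  The number \<open>l\<close> is the eigenvalue of frequency \<open>m\<close> for the discrete Dirichlet form, divided by the eigenvalue
  of frequency \<open>1\<close>. The bounds express a spectral gap which grows quadratically in the frequency,
  uniformly in \<open>n\<close>. They follow from \<open>l \<ge> 4 * m\<^sup>2 / pi\<^sup>2\<close> and \<open>pi\<^sup>2 \<le> 10\<close>; hence
  \<open>l \<ge> 2/5 * m\<^sup>2 \<ge> 8/5\<close>, from which \<open>1\<close> is subtracted in the form \<open>1 \<le> m\<^sup>2 / 4\<close> and \<open>1 \<le> 5/8 * l\<close>.
\<close>

lemma sin_ratio_lower_bounds:
  assumes n: "n = 2 * N + 1" and m: "2 \<le> m" "m \<le> N"
  defines "l \<equiv> (sin (pi * real m / real n) / sin (pi / real n))\<^sup>2"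
  shows "3/20 * (real m)\<^sup>2 \<le> l - 1" "3/8 * l \<le> l - 1"
proof -
  have n0: "real n > 0" "n \<ge> 5" using n m by auto
  have s1: "0 < sin (pi / n)" using n0 by (intro sin_gt_zero) (auto simp: field_simps)
  have s2: "sin (pi / n) \<le> pi / n" using n0 by (intro sin_x_le_x) auto
  have "2 * (pi * m / n) / pi \<le> sin (pi * m / n)"
  proof (intro sin_ge_two_div_pi)
    have "real m / n \<le> 1 / 2" using n0 m n by (simp add: divide_le_eq)
    then have "pi * (real m / n) \<le> pi * (1 / 2)" by (intro mult_left_mono) auto
    then show "pi * m / n \<le> pi / 2" by simp
  qed auto
  then have "2 * m / n \<le> sin (pi * m / n)" by simp
  then have "(2 * m / n) / (pi / n) \<le> sin (pi * m / n) / sin (pi / n)"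
    using s1 s2 by (intro frac_le) (auto intro: order_trans[rotated])
  then have "2 * m / pi \<le> sin (pi * m / n) / sin (pi / n)"
    using n0 by simp
  then have "(2 * m / pi)\<^sup>2 \<le> l"
    unfolding l_def by (intro power_mono) auto
  moreover have "(2 * m / pi)\<^sup>2 = 4 * (real m)\<^sup>2 / pi\<^sup>2"
    by (simp add: power_divide power_mult_distrib)
  moreover have "pi\<^sup>2 \<le> 10"
  proof -
    have "pi \<le> 3.15" using pi_approx by simp
    then have "pi\<^sup>2 \<le> 3.15\<^sup>2" by (intro power_mono) auto
    then show ?thesis by (simp add: power2_eq_square)
  qed
  then have "4 * (real m)\<^sup>2 / 10 \<le> 4 * (real m)\<^sup>2 / pi\<^sup>2"
    by (intro divide_left_mono) auto
  ultimately have l: "2/5 * (real m)\<^sup>2 \<le> l" by simp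
  have m2: "4 \<le> (real m)\<^sup>2" using power_mono[of 2 "real m" 2] m by simp
  show "3/20 * (real m)\<^sup>2 \<le> l - 1" "3/8 * l \<le> l - 1"
    using l m2 by simp_all
qed

text \<open>
  The number \<open>2 * sin (pi / n)\<close> is the side of the regular \<open>n\<close>-gon inscribed in the unit circle, so \<open>\<eta>\<close> is the amount
  by which \<open>w\<close> falls short of the mean square radius of that polygon, which has the same or longer sides.

  By the spectral gap, the deficit bounds the sum of \<open>j\<^sup>2 * (norm (b j))\<^sup>2\<close> over all frequencies \<open>j\<close> except
  \<open>0\<close>, \<open>1\<close> and \<open>-1\<close>, hence also the supremum of that part of \<open>w\<close>. What remains is an affine image
  of a regular polygon, \<open>b 1 * mode n 1 k + b (-1) * mode n (-1) k\<close>, and the quadratic form does not see the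
  difference between a circle and an ellipse. The bound on each individual side does: the normalized sides
  have norm at most \<open>1\<close> and mean square at least \<open>1 - \<eta>\<close>, so their squared norms are constant up to a mean
  error \<open>\<eta>\<close>, whereas an ellipse contributes the product of \<open>b 1\<close> and \<open>cnj (b (-1))\<close> as coefficient of frequency
  \<open>2\<close>. This product is therefore of order \<open>sqrt \<eta>\<close>, and one of the two coefficients must be small.
\<close>

lemma polygon_wirtinger_stability:
  fixes w :: "nat \<Rightarrow> complex"
  assumes N: "N \<ge> 2" and n: "n = 2 * N + 1"
    and loop: "w n = w 0" and centred: "(\<Sum>k<n. w k) = 0"
    and side: "\<And>k. k < n \<Longrightarrow> norm (w (Suc k) - w k) \<le> 2 * sin (pi / n)"
  defines "\<eta> \<equiv> 1 - (\<Sum>k<n. (norm (w k))\<^sup>2) / n"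
  shows "0 \<le> \<eta>"
    and "\<exists>\<alpha> s. norm \<alpha> = 1 \<and> \<bar>s\<bar> = 1 \<and> (\<forall>k<n. norm (w k - \<alpha> * mode n s k) \<le> 120 * sqrt \<eta>)"
proof -
  have n0: "n > 0" "n \<ge> 5" using n N by auto
  define J where "J = {- int N..int N}"
  define R where "R = {j \<in> J. 2 \<le> \<bar>j\<bar>}"
  have fin: "finite J" "finite R"
    unfolding R_def by (simp add: J_def, rule finite_subset[of _ J], auto simp: J_def)
  have Jsplit: "J = {0, 1, -1} \<union> R" "{0, 1, -1} \<inter> R = {}"
    using N by (auto simp: J_def R_def)
  have sumJ: "(\<Sum>j\<in>J. f j) = f 0 + f 1 + f (-1) + (\<Sum>j\<in>R. f j)" for f :: "int \<Rightarrow> 'b::comm_monoid_add"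
    unfolding Jsplit(1) by (subst sum.union_disjoint) (use fin Jsplit(2) in \<open>auto simp: add_ac\<close>)
  have incong: "\<And>i j. i \<in> J \<Longrightarrow> j \<in> J \<Longrightarrow> int n dvd i - j \<Longrightarrow> i = j"
    unfolding J_def n by (rule incongruent_symmetric_range)
  define b where "b j = (\<Sum>l<n. w l * mode n (- j) l) / of_nat n" for j
  have b0: "b 0 = 0" by (simp add: b_def centred)
  have W: "w k = (\<Sum>j\<in>J. b j * mode n j k)" if "k \<le> n" for k
  proof (cases "k = n")
    case True
    then show ?thesis
      using dft_inversion[OF n b_def, of 0] n0 by (simp add: loop mode_period J_def)
  next
    case False
    then show ?thesis
      using dft_inversion[OF n b_def, of k] that by (simp add: J_def)
  qed
  have P: "(\<Sum>j\<in>J. (norm (b j))\<^sup>2) = 1 - \<eta>"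
    using parseval_trig_polynomial[OF n0(1) fin(1) incong, of b] n0 by (simp add: W \<eta>_def)

  \<comment> \<open>The sides, normalized by their maximal admissible length, and their Fourier coefficients.\<close>
  define h where "h = 2 * sin (pi / n)"
  have h: "h > 0" unfolding h_def using n0 by (simp add: field_simps sin_gt_zero)
  define c where "c j = b j * (cis (2 * pi * of_int j / n) - 1) / of_real h" for j
  define l where "l j = (sin (pi * of_int j / n) / sin (pi / n))\<^sup>2" for j :: int
  have c0: "c 0 = 0" by (simp add: c_def)
  have cl: "(norm (c j))\<^sup>2 = l j * (norm (b j))\<^sup>2" for j
  proof -
    have "norm (cis (2 * pi * of_int j / n) - 1) = 2 * \<bar>sin (pi * of_int j / n)\<bar>"
      using norm_cis_diff[of "2 * pi * of_int j / n" 0] by simp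
    then show ?thesis
      using h by (simp add: c_def l_def norm_mult norm_divide power_mult_distrib power_divide h_def)
  qed
  have l1: "l 1 = 1" "l (-1) = 1" using h by (auto simp: l_def h_def)
  define y where "y k = (w (Suc k) - w k) / of_real h" for k
  have Y: "y k = (\<Sum>j\<in>J. c j * mode n j k)" if "k < n" for k
    using that by (simp add: y_def W mode_Suc c_def sum_divide_distrib diff_divide_distrib
        algebra_simps flip: sum_subtractf)
  have y1: "norm (y k) \<le> 1" if "k < n" for k
    using side[OF that] h by (simp add: y_def norm_divide h_def)
  have y12: "(norm (y k))\<^sup>2 \<le> 1" if "k < n" for k
    using y1[OF that] by (simp add: power_le_one)
  have Py: "(\<Sum>k<n. (norm (y k))\<^sup>2) = n * (\<Sum>j\<in>J. l j * (norm (b j))\<^sup>2)"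
    using parseval_trig_polynomial[OF n0(1) fin(1) incong, of c] by (simp add: Y cl)
  have "(\<Sum>k<n. (norm (y k))\<^sup>2) \<le> (\<Sum>k<n. 1)"
    by (intro sum_mono y12) auto
  then have energy: "(\<Sum>j\<in>J. l j * (norm (b j))\<^sup>2) \<le> 1"
    using Py n0 by simp

  have lR: "3/20 * (real_of_int j)\<^sup>2 \<le> l j - 1" "3/8 * l j \<le> l j - 1" if "j \<in> R" for j
  proof -
    have "l j = (sin (pi * real (nat \<bar>j\<bar>) / n) / sin (pi / n))\<^sup>2"
      unfolding l_def by (cases "j \<ge> 0") (auto simp: power_divide)
    moreover have "(real (nat \<bar>j\<bar>))\<^sup>2 = (real_of_int j)\<^sup>2"
      by simp
    moreover have "2 \<le> nat \<bar>j\<bar>" "nat \<bar>j\<bar> \<le> N"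
      using that by (auto simp: R_def J_def)
    ultimately show "3/20 * (real_of_int j)\<^sup>2 \<le> l j - 1" "3/8 * l j \<le> l j - 1"
      using sin_ratio_lower_bounds[OF n, of "nat \<bar>j\<bar>"] by metis+
  qed
  have gap: "(\<Sum>j\<in>R. (l j - 1) * (norm (b j))\<^sup>2) \<le> \<eta>"
    using energy P by (simp add: sumJ b0 l1 left_diff_distrib sum_subtractf)
  have sq: "(\<Sum>j\<in>R. (real_of_int j)\<^sup>2 * (norm (b j))\<^sup>2) \<le> 20/3 * \<eta>"
  proof -
    have "3/20 * (\<Sum>j\<in>R. (real_of_int j)\<^sup>2 * (norm (b j))\<^sup>2) \<le> (\<Sum>j\<in>R. (l j - 1) * (norm (b j))\<^sup>2)"
      unfolding sum_distrib_left using lR(1)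
      by (intro sum_mono) (metis mult.assoc mult_right_mono zero_le_power2)
    then show ?thesis using gap by simp
  qed
  have eng: "(\<Sum>j\<in>R. l j * (norm (b j))\<^sup>2) \<le> 3 * \<eta>"
  proof -
    have "3/8 * (\<Sum>j\<in>R. l j * (norm (b j))\<^sup>2) \<le> (\<Sum>j\<in>R. (l j - 1) * (norm (b j))\<^sup>2)"
      unfolding sum_distrib_left using lR(2)
      by (intro sum_mono) (metis mult.assoc mult_right_mono zero_le_power2)
    moreover have "0 \<le> (\<Sum>j\<in>R. (real_of_int j)\<^sup>2 * (norm (b j))\<^sup>2)"
      by (intro sum_nonneg) auto
    ultimately show ?thesis using gap sq by simp
  qed
  have "0 \<le> (\<Sum>j\<in>R. (real_of_int j)\<^sup>2 * (norm (b j))\<^sup>2)"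
    by (intro sum_nonneg) auto
  then show \<eta>0: "0 \<le> \<eta>" using sq by simp
  have mass: "(\<Sum>j\<in>R. (norm (b j))\<^sup>2) \<le> 2 * \<eta>"
  proof -
    have "4 * (\<Sum>j\<in>R. (norm (b j))\<^sup>2) \<le> (\<Sum>j\<in>R. (real_of_int j)\<^sup>2 * (norm (b j))\<^sup>2)"
      unfolding sum_distrib_left
    proof (intro sum_mono mult_right_mono)
      fix j assume "j \<in> R"
      then have "2\<^sup>2 \<le> \<bar>real_of_int j\<bar>\<^sup>2" by (intro power_mono) (auto simp: R_def)
      then show "4 \<le> (real_of_int j)\<^sup>2" by simp
    qed auto
    then show ?thesis using sq \<eta>0 by simp
  qed

  define e where "e = sqrt \<eta>"
  have e: "e \<ge> 0" "e\<^sup>2 = \<eta>" using \<eta>0 by (auto simp: e_def)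
  \<comment> \<open>The weights \<open>j\<^sup>2\<close> in \<open>sq\<close> make the coefficients themselves summable, by Cauchy-Schwarz.\<close>
  have supR: "(\<Sum>j\<in>R. norm (b j)) \<le> 4 * e"
  proof (rule power2_le_imp_le)
    have "(\<Sum>j\<in>R. 1 / (real_of_int j)\<^sup>2) \<le> 2"
    proof -
      have "R = int ` {2..N} \<union> (\<lambda>m. - int m) ` {2..N}"
      proof (intro equalityI subsetI)
        fix j assume j: "j \<in> R"
        show "j \<in> int ` {2..N} \<union> (\<lambda>m. - int m) ` {2..N}"
        proof (cases "j \<ge> 0")
          case True
          then have "j = int (nat j)" "nat j \<in> {2..N}" using j by (auto simp: R_def J_def)
          then show ?thesis by blast
        next
          case False
          then have "j = - int (nat (- j))" "nat (- j) \<in> {2..N}" using j by (auto simp: R_def J_def)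
          then show ?thesis by blast
        qed
      qed (auto simp: R_def J_def)
      then have "(\<Sum>j\<in>R. 1 / (real_of_int j)\<^sup>2)
          = (\<Sum>j\<in>int ` {2..N}. 1 / (real_of_int j)\<^sup>2) + (\<Sum>j\<in>(\<lambda>m. - int m) ` {2..N}. 1 / (real_of_int j)\<^sup>2)"
        by (simp only:) (intro sum.union_disjoint; auto)
      also have "\<dots> = (\<Sum>m=2..N. 1 / (real m)\<^sup>2) + (\<Sum>m=2..N. 1 / (real m)\<^sup>2)"
        by (simp add: sum.reindex inj_on_def)
      finally show ?thesis using sum_inverse_squares_le[of N] by simp
    qed
    have "(\<Sum>j\<in>R. norm (b j))\<^sup>2 = (\<Sum>j\<in>R. (1 / of_int j) * (of_int j * norm (b j)))\<^sup>2"
      by (intro arg_cong[of _ _ "\<lambda>x. x\<^sup>2"] sum.cong) (auto simp: R_def)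
    also have "\<dots> \<le> (\<Sum>j\<in>R. (1 / of_int j)\<^sup>2) * (\<Sum>j\<in>R. (of_int j * norm (b j))\<^sup>2)"
      by (rule Cauchy_Schwarz_ineq_sum)
    also have "\<dots> \<le> 2 * (20/3 * \<eta>)"
      using \<open>_ \<le> 2\<close> sq by (intro mult_mono) (auto simp: power_divide power_mult_distrib intro: sum_nonneg)
    also have "\<dots> \<le> (4 * e)\<^sup>2"
      using e \<eta>0 by (simp add: power_mult_distrib)
    finally show "(\<Sum>j\<in>R. norm (b j))\<^sup>2 \<le> (4 * e)\<^sup>2" .
  qed (use e in auto)

  \<comment> \<open>The elliptic part \<open>u\<close> of the normalized sides, and the remainder, which is of order \<open>sqrt \<eta>\<close> in mean square.\<close>
  define u where "u k = c 1 * mode n 1 k + c (-1) * mode n (-1) k" for k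
  define \<rho> where "\<rho> k = (\<Sum>j\<in>R. c j * mode n j k)" for k
  have yu: "y k = u k + \<rho> k" if "k < n" for k
    using Y[OF that] by (simp add: sumJ c0 u_def \<rho>_def)
  have P\<rho>: "(\<Sum>k<n. (norm (\<rho> k))\<^sup>2) \<le> n * (3 * \<eta>)"
  proof -
    have "(\<Sum>k<n. (norm (\<rho> k))\<^sup>2) = n * (\<Sum>j\<in>R. l j * (norm (b j))\<^sup>2)"
      unfolding \<rho>_def using incong by (subst parseval_trig_polynomial) (auto simp: n0 fin cl R_def)
    then show ?thesis using eng n0 by simp
  qed
  have Pu: "(\<Sum>k<n. (norm (u k))\<^sup>2) \<le> n"
  proof -
    have "u k = (\<Sum>j\<in>{1,-1}. c j * mode n j k)" for k by (simp add: u_def)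
    then have "(\<Sum>k<n. (norm (u k))\<^sup>2) = n * (\<Sum>j\<in>{1,-1}. (norm (c j))\<^sup>2)"
    proof (subst parseval_trig_polynomial[symmetric])
      have "\<not> int n dvd 2" using n0 by (auto dest: zdvd_imp_le)
      then show "i = j" if "i \<in> {1, -1}" "j \<in> {1, -1}" "int n dvd i - j" for i j :: int
        using that by auto
    qed (simp_all add: n0)
    also have "(\<Sum>j\<in>{1,-1}. (norm (c j))\<^sup>2) \<le> 1"
    proof -
      have "0 \<le> (\<Sum>j\<in>R. l j * (norm (b j))\<^sup>2)" by (intro sum_nonneg) (auto simp: l_def)
      then show ?thesis using energy by (simp add: sumJ b0 cl)
    qed
    finally show ?thesis using n0 by simp
  qed
  \<comment> \<open>Multiplication by the character of frequency \<open>-2\<close> extracts the mixed product of the two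
    coefficients; the constant terms and the conjugate product cancel because of these two sums.\<close>
  have m2: "(\<Sum>k<n. mode n (-2) k) = 0" "(\<Sum>k<n. mode n (-4) k) = 0"
    using n0 by (auto simp: sum_mode dest: zdvd_imp_le)
  have Su: "(\<Sum>k<n. complex_of_real ((norm (u k))\<^sup>2) * mode n (-2) k) = n * (c 1 * cnj (c (-1)))"
  proof -
    have "complex_of_real ((norm (u k))\<^sup>2) * mode n (-2) k
        = (c 1 * cnj (c 1) + c (-1) * cnj (c (-1))) * mode n (-2) k
          + c 1 * cnj (c (-1)) + c (-1) * cnj (c 1) * mode n (-4) k" for k
    proof -
      have "complex_of_real ((norm (u k))\<^sup>2) * mode n (-2) k
          = (c 1 * mode n 1 k + c (-1) * mode n (-1) k)
            * (cnj (c 1) * mode n (-1) k + cnj (c (-1)) * mode n 1 k) * mode n (-2) k"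
        by (simp only: complex_norm_square) (simp add: u_def cnj_mode)
      also have "\<dots> = c 1 * cnj (c 1) * (mode n 1 k * mode n (-1) k * mode n (-2) k)
          + c (-1) * cnj (c (-1)) * (mode n (-1) k * mode n 1 k * mode n (-2) k)
          + c 1 * cnj (c (-1)) * (mode n 1 k * mode n 1 k * mode n (-2) k)
          + c (-1) * cnj (c 1) * (mode n (-1) k * mode n (-1) k * mode n (-2) k)"
        by (simp add: algebra_simps)
      finally show ?thesis
        unfolding mode_mult by (simp add: algebra_simps)
    qed
    then show ?thesis
      by (simp add: sum.distrib m2 flip: sum_distrib_left)
  qed
  \<comment> \<open>Subtracting the constant \<open>1\<close> does not change this coefficient and leaves a function of constant sign,
    whose mean is controlled by \<open>\<eta>\<close>.\<close>
  have Sy: "norm (\<Sum>k<n. complex_of_real ((norm (y k))\<^sup>2) * mode n (-2) k) \<le> n * \<eta>"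
  proof -
    have "(\<Sum>k<n. complex_of_real ((norm (y k))\<^sup>2) * mode n (-2) k)
        = (\<Sum>k<n. complex_of_real ((norm (y k))\<^sup>2 - 1) * mode n (-2) k)"
      by (simp add: left_diff_distrib sum_subtractf m2)
    also have "norm \<dots> \<le> (\<Sum>k<n. norm (complex_of_real ((norm (y k))\<^sup>2 - 1) * mode n (-2) k))"
      by (rule norm_sum)
    also have "\<dots> = (\<Sum>k<n. 1 - (norm (y k))\<^sup>2)"
      by (intro sum.cong refl) (use y12 in \<open>auto simp: norm_mult simp del: of_real_diff of_real_power\<close>)
    also have "\<dots> = n * (1 - (\<Sum>j\<in>J. l j * (norm (b j))\<^sup>2))"
      by (simp add: sum_subtractf Py right_diff_distrib)
    also have "\<dots> \<le> n * \<eta>"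
    proof (intro mult_left_mono)
      have "0 \<le> (\<Sum>j\<in>R. (l j - 1) * (norm (b j))\<^sup>2)"
      proof (intro sum_nonneg mult_nonneg_nonneg)
        fix j assume "j \<in> R"
        then show "0 \<le> l j - 1"
          using lR(1)[of j] by (intro order_trans[OF _ lR(1)]) auto
      qed auto
      then show "1 - (\<Sum>j\<in>J. l j * (norm (b j))\<^sup>2) \<le> \<eta>"
        using P by (simp add: sumJ b0 l1 left_diff_distrib sum_subtractf)
    qed auto
    finally show ?thesis .
  qed
  have Sd: "norm (\<Sum>k<n. complex_of_real ((norm (u k))\<^sup>2 - (norm (y k))\<^sup>2) * mode n (-2) k)
      \<le> n * (3 * \<eta> + 4 * e)"
  proof -
    have "norm (\<Sum>k<n. complex_of_real ((norm (u k))\<^sup>2 - (norm (y k))\<^sup>2) * mode n (-2) k)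
        \<le> (\<Sum>k<n. norm (complex_of_real ((norm (u k))\<^sup>2 - (norm (y k))\<^sup>2) * mode n (-2) k))"
      by (rule norm_sum)
    also have "\<dots> = (\<Sum>k<n. \<bar>(norm (u k))\<^sup>2 - (norm (y k))\<^sup>2\<bar>)"
      by (simp add: norm_mult del: of_real_diff of_real_power)
    also have "\<dots> \<le> (\<Sum>k<n. (norm (\<rho> k))\<^sup>2 + 2 * (norm (u k) * norm (\<rho> k)))"
    proof (intro sum_mono)
      fix k assume "k \<in> {..<n}"
      then have "norm (y k) \<le> norm (u k) + norm (\<rho> k)" "norm (u k) \<le> norm (y k) + norm (\<rho> k)"
        using yu[of k] norm_triangle_ineq[of "u k" "\<rho> k"] norm_triangle_ineq4[of "y k" "\<rho> k"] by auto
      then have d: "\<bar>norm (u k) - norm (y k)\<bar> \<le> norm (\<rho> k)" by linarith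
      have "\<bar>(norm (u k))\<^sup>2 - (norm (y k))\<^sup>2\<bar> = \<bar>norm (u k) - norm (y k)\<bar> * (norm (u k) + norm (y k))"
        by (simp add: power2_eq_square square_diff_square_factored abs_mult)
      also have "\<dots> \<le> norm (\<rho> k) * (norm (u k) + (norm (u k) + norm (\<rho> k)))"
        using d by (intro mult_mono) auto
      finally show "\<bar>(norm (u k))\<^sup>2 - (norm (y k))\<^sup>2\<bar> \<le> (norm (\<rho> k))\<^sup>2 + 2 * (norm (u k) * norm (\<rho> k))"
        by (simp add: power2_eq_square algebra_simps)
    qed
    also have "\<dots> = (\<Sum>k<n. (norm (\<rho> k))\<^sup>2) + 2 * (\<Sum>k<n. norm (u k) * norm (\<rho> k))"
      by (simp add: sum.distrib sum_distrib_left)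
    also have "(\<Sum>k<n. norm (u k) * norm (\<rho> k)) \<le> n * (2 * e)"
    proof (rule power2_le_imp_le)
      have "(\<Sum>k<n. norm (u k) * norm (\<rho> k))\<^sup>2 \<le> (\<Sum>k<n. (norm (u k))\<^sup>2) * (\<Sum>k<n. (norm (\<rho> k))\<^sup>2)"
        by (rule Cauchy_Schwarz_ineq_sum)
      also have "\<dots> \<le> n * (n * (3 * \<eta>))"
        using Pu P\<rho> by (intro mult_mono) (auto intro: sum_nonneg)
      also have "\<dots> \<le> (n * (2 * e))\<^sup>2"
        using e \<eta>0 by (simp add: power_mult_distrib power2_eq_square[of "real n"] mult_left_mono)
      finally show "(\<Sum>k<n. norm (u k) * norm (\<rho> k))\<^sup>2 \<le> (n * (2 * e))\<^sup>2" .
    qed (use e in auto)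
    finally show ?thesis using P\<rho> by (simp add: algebra_simps)
  qed
  have nb: "norm (c 1) = norm (b 1)" "norm (c (-1)) = norm (b (-1))"
    using cl[of 1] cl[of "-1"] by (simp_all add: l1)
  have "n * (norm (b 1) * norm (b (-1))) \<le> n * (4 * \<eta> + 4 * e)"
  proof -
    have "n * (norm (b 1) * norm (b (-1)))
        = norm (\<Sum>k<n. complex_of_real ((norm (u k))\<^sup>2) * mode n (-2) k)"
      unfolding Su by (simp add: norm_mult nb)
    also have "(\<Sum>k<n. complex_of_real ((norm (u k))\<^sup>2) * mode n (-2) k)
        = (\<Sum>k<n. complex_of_real ((norm (u k))\<^sup>2 - (norm (y k))\<^sup>2) * mode n (-2) k)
          + (\<Sum>k<n. complex_of_real ((norm (y k))\<^sup>2) * mode n (-2) k)"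
      by (simp add: left_diff_distrib sum_subtractf)
    also have "norm \<dots> \<le> n * (3 * \<eta> + 4 * e) + n * \<eta>"
      by (intro order_trans[OF norm_triangle_ineq] add_mono Sd Sy)
    finally show ?thesis by (simp add: algebra_simps)
  qed
  then have prod: "norm (b 1) * norm (b (-1)) \<le> 4 * \<eta> + 4 * e"
    using n0 by simp
  have two: "(norm (b 1))\<^sup>2 + (norm (b (-1)))\<^sup>2 \<le> 1" "1 - 3 * \<eta> \<le> (norm (b 1))\<^sup>2 + (norm (b (-1)))\<^sup>2"
  proof -
    have "0 \<le> (\<Sum>j\<in>R. (norm (b j))\<^sup>2)" by (intro sum_nonneg) auto
    then show "(norm (b 1))\<^sup>2 + (norm (b (-1)))\<^sup>2 \<le> 1" "1 - 3 * \<eta> \<le> (norm (b 1))\<^sup>2 + (norm (b (-1)))\<^sup>2"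
      using P mass \<eta>0 by (auto simp: sumJ b0)
  qed
  \<comment> \<open>The orientation of the nearby regular polygon is that of the dominant coefficient.\<close>
  define s :: int where "s = (if norm (b (-1)) \<le> norm (b 1) then 1 else -1)"
  define \<alpha> where "\<alpha> = (if b s = 0 then 1 else sgn (b s))"
  have s: "\<bar>s\<bar> = 1" by (simp add: s_def)
  have \<alpha>: "norm \<alpha> = 1" by (simp add: \<alpha>_def norm_sgn)
  \<comment> \<open>The case of a vanishing coefficient is possible only for large \<open>\<eta>\<close>, but then any \<open>\<alpha>\<close> of norm \<open>1\<close> serves.\<close>
  have b\<alpha>: "b s - \<alpha> = of_real (norm (b s) - 1) * \<alpha>"
  proof (cases "b s = 0")
    case False
    then have "b s = of_real (norm (b s)) * \<alpha>"
      by (simp add: \<alpha>_def sgn_eq)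
    then show ?thesis by (simp add: left_diff_distrib)
  qed (simp add: \<alpha>_def)
  have est: "\<bar>norm (b s) - 1\<bar> + norm (b (- s)) + 4 * e \<le> 120 * e"
    by (rule two_mode_estimate) (use two prod e in \<open>auto simp: s_def mult.commute add.commute\<close>)
  have "norm (w k - \<alpha> * mode n s k) \<le> 120 * e" if k: "k < n" for k
  proof -
    have "w k = b s * mode n s k + b (- s) * mode n (- s) k + (\<Sum>j\<in>R. b j * mode n j k)"
      using W[of k] k by (simp add: sumJ b0 s_def)
    then have "w k - \<alpha> * mode n s k
        = of_real (norm (b s) - 1) * \<alpha> * mode n s k + b (- s) * mode n (- s) k + (\<Sum>j\<in>R. b j * mode n j k)"
      unfolding b\<alpha>[symmetric] by (simp add: algebra_simps)
    also have "norm \<dots> \<le> norm (of_real (norm (b s) - 1) * \<alpha> * mode n s k) + norm (b (- s) * mode n (- s) k)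
        + norm (\<Sum>j\<in>R. b j * mode n j k)"
      by (intro order_trans[OF norm_triangle_ineq] add_mono norm_triangle_ineq order_refl)
    also have "\<dots> \<le> \<bar>norm (b s) - 1\<bar> + norm (b (- s)) + (\<Sum>j\<in>R. norm (b j))"
    proof (intro add_mono)
      show "norm (\<Sum>j\<in>R. b j * mode n j k) \<le> (\<Sum>j\<in>R. norm (b j))"
        by (rule order_trans[OF norm_sum]) (simp add: norm_mult)
    qed (simp_all add: norm_mult \<alpha> del: of_real_diff)
    finally show ?thesis using supR est by simp
  qed
  then show "\<exists>\<alpha> s. norm \<alpha> = 1 \<and> \<bar>s\<bar> = 1 \<and> (\<forall>k<n. norm (w k - \<alpha> * mode n s k) \<le> 120 * sqrt \<eta>)"
    using s \<alpha> e_def by blast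
qed

section \<open>From polygons to convex sets\<close>

lemma partition_covers:
  fixes t :: "nat \<Rightarrow> real"
  assumes "t 0 \<le> s" "s \<le> t n" "n > 0"
  obtains k where "k < n" "t k \<le> s" "s \<le> t (Suc k)"
proof -
  define j where "j = (LEAST k. s \<le> t (Suc k))"
  have ex: "s \<le> t (Suc (n - 1))" using assms by simp
  have j: "s \<le> t (Suc j)" unfolding j_def by (rule LeastI[of _ "n - 1"]) (rule ex)
  have "j \<le> n - 1" unfolding j_def by (rule Least_le) (rule ex)
  moreover have "t j \<le> s"
  proof (cases j)
    case (Suc i)
    then have "\<not> s \<le> t (Suc i)" using not_less_Least[of i "\<lambda>k. s \<le> t (Suc k)"] by (simp add: j_def)
    then show ?thesis using Suc by simp
  qed (use assms in simp)
  ultimately show ?thesis using that[of j] j assms by simp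
qed

text \<open>
  A Riemann sum bound: arcs of mass at most \<open>h\<close> have diameter at most \<open>h\<close>. The closed arcs overlap in their
  endpoints, which is harmless for an upper bound of a nonnegative integrand.
\<close>

lemma second_moment_le_partition_sum:
  fixes p :: "real \<Rightarrow> 'a::euclidean_space"
  assumes p: "parametrized_loop p" and fin: "emeasure hausdorff1 (p ` {0..2*pi}) < \<infinity>"
    and n: "n > 0" and t: "t 0 = 0" "t n = 2*pi"
    and step: "\<And>k. k < n \<Longrightarrow> 0 \<le> t k \<and> t k \<le> t (Suc k) \<and> t (Suc k) \<le> 2*pi"
    and mass: "\<And>k. k < n \<Longrightarrow> measure hausdorff1 (p ` {t k..t (Suc k)}) \<le> h"
  shows "(LINT x:p ` {0..2*pi}|hausdorff1. (norm (x - m))\<^sup>2)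
      \<le> h * (\<Sum>k<n. (norm (p (t k) - m) + h)\<^sup>2)"
proof -
  interpret parametrized_loop p by fact
  define A where "A k = p ` {t k..t (Suc k)}" for k
  define c where "c k = (norm (p (t k) - m) + h)\<^sup>2" for k
  have As: "A k \<in> sets borel" "emeasure hausdorff1 (A k) < \<infinity>" if "k < n" for k
  proof -
    show "A k \<in> sets borel" unfolding A_def using step[OF that] by (intro arc_sets) auto
    have "emeasure hausdorff1 (A k) \<le> emeasure hausdorff1 (p ` {0..2*pi})"
      unfolding A_def using step[OF that] arc_sets[of 0 "2*pi"] by (intro emeasure_mono) auto
    then show "emeasure hausdorff1 (A k) < \<infinity>" using fin by simp
  qed
  have int: "integrable hausdorff1 (\<lambda>x. c k * indicator (A k) x)" if "k < n" for k
    using As[OF that] by (intro integrable_mult_right integrable_real_indicator) auto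
  have "(LINT x:p ` {0..2*pi}|hausdorff1. (norm (x - m))\<^sup>2)
      \<le> (\<integral>x. (\<Sum>k<n. c k * indicator (A k) x) \<partial>hausdorff1)"
    unfolding set_lebesgue_integral_def
  proof (rule integral_mono')
    show "integrable hausdorff1 (\<lambda>x. \<Sum>k<n. c k * indicator (A k) x)"
      using int by (intro Bochner_Integration.integrable_sum) auto
    fix x :: 'a
    show nn: "0 \<le> (\<Sum>k<n. c k * indicator (A k) x)"
      by (intro sum_nonneg) (auto simp: c_def)
    show "indicat_real (p ` {0..2*pi}) x *\<^sub>R (norm (x - m))\<^sup>2 \<le> (\<Sum>k<n. c k * indicator (A k) x)"
    proof (cases "x \<in> p ` {0..2*pi}")
      case True
      then obtain s where s: "x = p s" "0 \<le> s" "s \<le> 2*pi" by auto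
      obtain k where k: "k < n" "t k \<le> s" "s \<le> t (Suc k)"
        using partition_covers[of t s n] s t n by auto
      have "dist (p s) (p (t k)) \<le> measure hausdorff1 (p ` {t k..t (Suc k)})"
        using k step[OF k(1)] by (intro chord_le_arc fin) auto
      then have "dist x (p (t k)) \<le> h" using mass[OF k(1)] s by simp
      then have "norm (x - m) \<le> norm (p (t k) - m) + h"
        using norm_triangle_ineq[of "x - p (t k)" "p (t k) - m"] by (simp add: dist_norm)
      then have "(norm (x - m))\<^sup>2 \<le> c k * indicator (A k) x"
        using s k by (auto simp: c_def A_def intro!: power_mono)
      also have "\<dots> \<le> (\<Sum>k<n. c k * indicator (A k) x)"
        using k by (intro member_le_sum) (auto simp: c_def)
      finally show ?thesis using True by simp
    qed (use nn in simp)
  qed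
  also have "\<dots> = (\<Sum>k<n. c k * measure hausdorff1 (A k))"
    using int As by (subst Bochner_Integration.integral_sum) auto
  also have "\<dots> \<le> (\<Sum>k<n. c k * h)"
    using mass by (intro sum_mono mult_left_mono) (auto simp: A_def c_def)
  finally show ?thesis by (simp add: c_def sum_distrib_left mult.commute)
qed

text \<open>
  The points within distance \<open>d\<close> of a convex set form a convex set.
\<close>

lemma convex_hull_dist_le:
  fixes A B :: "'a::real_normed_vector set"
  assumes AB: "\<And>a. a \<in> A \<Longrightarrow> \<exists>b\<in>B. dist a b \<le> d" and x: "x \<in> convex hull A"
  shows "\<exists>y\<in>convex hull B. dist x y \<le> d"
proof -
  have "convex {x. \<exists>y\<in>convex hull B. dist x y \<le> d}"
  proof (rule convexI, clarify)
    fix x y x' y' and u v :: real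
    assume h: "x' \<in> convex hull B" "dist x x' \<le> d" "y' \<in> convex hull B" "dist y y' \<le> d"
      and uv: "0 \<le> u" "0 \<le> v" "u + v = 1"
    show "\<exists>z\<in>convex hull B. dist (u *\<^sub>R x + v *\<^sub>R y) z \<le> d"
    proof
      have "(u *\<^sub>R x + v *\<^sub>R y) - (u *\<^sub>R x' + v *\<^sub>R y') = u *\<^sub>R (x - x') + v *\<^sub>R (y - y')"
        by (simp add: algebra_simps)
      then have "dist (u *\<^sub>R x + v *\<^sub>R y) (u *\<^sub>R x' + v *\<^sub>R y') \<le> u * dist x x' + v * dist y y'"
        using uv norm_triangle_ineq[of "u *\<^sub>R (x - x')" "v *\<^sub>R (y - y')"] by (simp add: dist_norm)
      also have "\<dots> \<le> u * d + v * d"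
        using h uv by (intro add_mono mult_left_mono)
      finally show "dist (u *\<^sub>R x + v *\<^sub>R y) (u *\<^sub>R x' + v *\<^sub>R y') \<le> d"
        using uv by (simp flip: distrib_right)
      show "u *\<^sub>R x' + v *\<^sub>R y' \<in> convex hull B"
        using h uv by (intro convexD[OF convex_convex_hull])
    qed
  qed
  moreover have "A \<subseteq> {x. \<exists>y\<in>convex hull B. dist x y \<le> d}"
    using AB hull_subset[of B convex] by blast
  ultimately have "convex hull A \<subseteq> {x. \<exists>y\<in>convex hull B. dist x y \<le> d}"
    by (intro hull_minimal)
  then show ?thesis using x by blast
qed

lemma hausdorff_dist_convex_hull_le:
  fixes A B :: "'a::real_normed_vector set"
  assumes "A \<noteq> {}" "B \<noteq> {}" "\<And>a. a \<in> A \<Longrightarrow> \<exists>b\<in>B. dist a b \<le> d"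
    "\<And>b. b \<in> B \<Longrightarrow> \<exists>a\<in>A. dist b a \<le> d"
  shows "hausdorff_dist (convex hull A) (convex hull B) \<le> d"
proof -
  have "infdist x (convex hull B) \<le> d" if "x \<in> convex hull A" for x
    using convex_hull_dist_le[of A B d x] assms that infdist_le2 by metis
  moreover have "infdist x (convex hull A) \<le> d" if "x \<in> convex hull B" for x
    using convex_hull_dist_le[of B A d x] assms that infdist_le2 by metis
  ultimately show ?thesis
    unfolding hausdorff_dist_def using assms by (intro max.boundedI cSUP_least) auto
qed

lemma hausdorff_dist_nonneg:
  assumes "A \<noteq> {}" "bounded A" "B \<noteq> {}"
  shows "0 \<le> hausdorff_dist A B"
proof -
  obtain a b where ab: "a \<in> A" "b \<in> B" using assms by blast
  obtain e where e: "\<forall>x\<in>A. dist b x \<le> e" using assms(2) bounded_any_center by blast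
  have "bdd_above ((\<lambda>a. infdist a B) ` A)"
    by (rule bdd_aboveI2[of _ _ e]) (use e ab in \<open>auto simp: dist_commute intro: infdist_le2\<close>)
  then have "0 \<le> (SUP a\<in>A. infdist a B)"
    using ab by (intro cSUP_upper2[of _ _ a]) (auto simp: infdist_nonneg)
  then show ?thesis unfolding hausdorff_dist_def by simp
qed

text \<open>
  The vertices of a regular \<open>n\<close>-gon divide the circle into arcs of length \<open>2 * pi / n\<close>; the orientation \<open>s = -1\<close> is
  reduced to \<open>s = 1\<close> by complex conjugation.
\<close>

lemma modes_dense_in_circle:
  assumes z: "norm z = 1" and s: "\<bar>s\<bar> = 1" and n: "n > 0"
  shows "\<exists>k<n. norm (z - mode n s k) \<le> 2 * pi / n"
proof -
  have pos: "\<exists>k<n. norm (z - mode n 1 k) \<le> 2 * pi / n" if "norm z = 1" for z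
  proof -
    define \<theta> where "\<theta> = Arg2pi z"
    have \<theta>: "0 \<le> \<theta>" "\<theta> < 2 * pi" "z = cis \<theta>"
      using Arg2pi_ge_0[of z] Arg2pi_lt_2pi[of z] Arg2pi_eq[of z] that by (auto simp: \<theta>_def cis_conv_exp)
    define k where "k = nat \<lfloor>\<theta> * n / (2 * pi)\<rfloor>"
    have "0 \<le> \<theta> * n / (2 * pi)" using \<theta> by simp
    then have k: "real k \<le> \<theta> * n / (2 * pi)" "\<theta> * n / (2 * pi) < real k + 1"
      by (auto simp: k_def)
    have "\<theta> * n / (2 * pi) < n" using \<theta> n by (simp add: divide_less_eq mult.commute)
    then have "k < n" using k by linarith
    moreover have "\<bar>\<theta> - 2 * pi * k / n\<bar> \<le> 2 * pi / n"
    proof -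
      have "2 * pi * k / n \<le> \<theta>" "\<theta> \<le> 2 * pi * k / n + 2 * pi / n"
        using k n by (simp_all add: field_simps)
      then show ?thesis by simp
    qed
    then have "norm (z - mode n 1 k) \<le> 2 * pi / n"
      using norm_cis_diff_le[of \<theta> "2 * pi * k / n"] by (simp add: \<theta> mode_def)
    ultimately show ?thesis by blast
  qed
  show ?thesis
  proof (cases "s = 1")
    case False
    then have s: "s = -1" using s by simp
    obtain k where "k < n" "norm (cnj z - mode n 1 k) \<le> 2 * pi / n"
      using pos[of "cnj z"] z by auto
    moreover have "norm (cnj z - mode n 1 k) = norm (z - mode n s k)"
      using complex_mod_cnj[of "z - mode n s k"] by (simp add: cnj_mode s)
    ultimately show ?thesis by auto
  qed (use pos z in auto)
qed

lemma perimeter_convex_pos: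
  assumes E: "E \<noteq> {}" "open E" "bounded E" "convex E"
  shows "perimeter E > 0"
proof -
  obtain p where p: "parametrized_loop p" "p ` {0..2*pi} = frontier E"
    using frontier_convex_parametrization[OF E] .
  interpret parametrized_loop p by fact
  have "p 0 \<noteq> p pi"
    using inj_onD[OF inj, of 0 pi] pi_gt_zero by auto
  moreover have "dist (p 0) (p pi) \<le> measure hausdorff1 (p ` {0..2*pi})"
    using hausdorff1_frontier_convex_finite[OF E] p(2) pi_gt_zero by (intro chord_le_arc) auto
  ultimately show ?thesis
    using p(2) by (simp add: perimeter_def zero_less_dist_iff[THEN iffD2, THEN less_le_trans])
qed

text \<open>
  The second bound holds for every centre \<open>c\<close> and thus allows a centre that varies with the approximating
  polygon.
\<close>

lemma asymmetry_bounds: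
  assumes E: "E \<noteq> {}" "open E" "bounded E" "convex E"
  shows "0 \<le> asymmetry E"
    and "asymmetry E \<le> hausdorff_dist (closure E) (closure (ball c (perimeter E / (2*pi))))
           / (perimeter E / (2*pi))"
proof -
  let ?S = "{hausdorff_dist (closure E) (closure (ball x\<^sub>0 r)) / r | x\<^sub>0 r.
         r > 0 \<and> perimeter (ball x\<^sub>0 r) = perimeter E}"
  have nonneg: "0 \<le> x" if "x \<in> ?S" for x
  proof -
    have "0 \<le> hausdorff_dist (closure E) (closure (ball x\<^sub>0 r))" if "r > 0" for x\<^sub>0 r
      using E that by (intro hausdorff_dist_nonneg) auto
    then show ?thesis using that by auto
  qed
  have mem: "hausdorff_dist (closure E) (closure (ball c (perimeter E / (2*pi))))
           / (perimeter E / (2*pi)) \<in> ?S"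
    using perimeter_convex_pos[OF E] by (auto simp: perimeter_ball intro!: exI[of _ c] exI[of _ "perimeter E / (2*pi)"])
  show "0 \<le> asymmetry E"
    unfolding asymmetry_def using mem nonneg by (intro cInf_greatest) blast+
  show "asymmetry E \<le> hausdorff_dist (closure E) (closure (ball c (perimeter E / (2*pi))))
           / (perimeter E / (2*pi))"
    unfolding asymmetry_def using mem nonneg by (intro cInf_lower bdd_belowI[of _ 0])
qed

text \<open>
  Both closed sets are the convex hulls of their boundaries, so it suffices to compare the boundaries.
\<close>

lemma hausdorff_dist_convex_ball_le:
  fixes E :: "'a::euclidean_space set"
  assumes E: "open E" "bounded E" "convex E" "frontier E \<noteq> {}" and r: "r > 0"
    and "\<And>x. x \<in> frontier E \<Longrightarrow> \<exists>y\<in>sphere c r. dist x y \<le> d"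
    and "\<And>y. y \<in> sphere c r \<Longrightarrow> \<exists>x\<in>frontier E. dist y x \<le> d"
  shows "hausdorff_dist (closure E) (closure (ball c r)) \<le> d"
proof -
  have "closure E = convex hull (frontier E)"
    using Krein_Milman_frontier[of "closure E"] E by (simp add: frontier_def convex_interior_closure convex_closure)
  moreover have "closure (ball c r) = convex hull (sphere c r)"
    using Krein_Milman_frontier[of "cball c r"] r by simp
  moreover have "sphere c r \<noteq> {}" using r by simp
  ultimately show ?thesis
    using assms by (simp only:) (intro hausdorff_dist_convex_hull_le; blast)
qed

text \<open>
  The polygon theorem is applied to \<open>n\<close> boundary points that cut the boundary into arcs of equal mass,
  translated by their barycentre \<open>m\<close> and rescaled by \<open>r * g\<close>. The factor \<open>g\<close> compares the arc and the chord of a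
  regular \<open>n\<close>-gon and tends to \<open>1\<close>; it turns the side bound \<open>L / n\<close> into exactly \<open>2 * sin (pi / n)\<close>. Replacing
  the integral by a sum over the points costs at most \<open>3 * L ^ 3 / n\<close>, and replacing the curves by their
  vertices costs at most \<open>L / n\<close> in Hausdorff distance, so that all errors vanish as \<open>n\<close> grows.
\<close>

lemma asymmetry_le_discrete:
  fixes E :: "(real^2) set" and N n :: nat
  assumes E: "E \<noteq> {}" "open E" "bounded E" "convex E" and N: "N \<ge> 2" and n: "n = 2 * N + 1"
  defines "\<Delta> \<equiv> 1 / (2 * pi)\<^sup>2
      - (INF x\<^sub>0. LINT x:frontier E|hausdorff1. (norm (x - x\<^sub>0))\<^sup>2) / perimeter E ^ 3"
    and "g \<equiv> (pi / n) / sin (pi / n)"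
  shows "asymmetry E \<le> 120 * g * sqrt (1 - (1 - 4 * pi\<^sup>2 * (\<Delta> + 3 / n)) / g\<^sup>2) + \<bar>g - 1\<bar> + 2 * pi / n"
proof -
  have n0: "n > 0" "n \<ge> 5" using n N by auto
  have sin_pos: "sin (pi / n) > 0" using n0 by (intro sin_gt_zero) (auto simp: field_simps)
  have g0: "g > 0" using sin_pos n0 by (simp add: g_def)
  obtain p where p: "parametrized_loop p" "p ` {0..2*pi} = frontier E"
    using frontier_convex_parametrization[OF E] .
  interpret parametrized_loop p by fact
  define L where "L = perimeter E"
  have Lp: "L = measure hausdorff1 (p ` {0..2*pi})" by (simp add: L_def perimeter_def p)
  have L0: "L > 0" unfolding L_def by (rule perimeter_convex_pos[OF E])
  have fin: "emeasure hausdorff1 (p ` {0..2*pi}) < \<infinity>"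
    using hausdorff1_frontier_convex_finite[OF E] p by simp
  obtain t where t: "t 0 = 0" "t n = 2*pi"
    and step: "\<And>k. k < n \<Longrightarrow> 0 \<le> t k \<and> t k \<le> t (Suc k) \<and> t (Suc k) \<le> 2*pi"
    and mass: "\<And>k. k < n \<Longrightarrow> measure hausdorff1 (p ` {t k..t (Suc k)}) \<le> L / n"
    using equal_mass_partition[of L n] fin Lp L0 n0(1) by blast
  define z where "z k = complex_of_plane (p (t k))" for k
  define m where "m = (\<Sum>k<n. z k) / n"
  define c where "c = plane_of_complex m"
  define r where "r = L / (2 * pi)"
  have r0: "r > 0" using L0 by (simp add: r_def)
  have L_r: "L = 2 * pi * r" by (simp add: r_def)
  define w where "w k = (z k - m) / of_real (r * g)" for k
  have norm_z: "norm (z k - z j) = dist (p (t k)) (p (t j))" for k j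
    by (simp add: z_def dist_norm flip: complex_of_plane_diff)
  have pm: "norm (p (t k) - c) = norm (z k - m)" for k
    using norm_complex_of_plane[of "p (t k) - c"] by (simp add: complex_of_plane_diff c_def z_def)

  \<comment> \<open>The factor \<open>\<alpha>\<close> is a rotation and \<open>s\<close> the orientation of the nearby regular polygon.\<close>
  obtain \<alpha> s where \<alpha>: "norm \<alpha> = 1" and s: "\<bar>s\<bar> = 1"
    and close: "\<And>k. k < n \<Longrightarrow>
      norm (w k - \<alpha> * mode n s k) \<le> 120 * sqrt (1 - (\<Sum>k<n. (norm (w k))\<^sup>2) / n)"
  proof -
    have "w n = w 0" by (simp add: w_def z_def t closed)
    moreover have "(\<Sum>k<n. w k) = 0"
      using n0 by (simp add: w_def m_def sum_subtractf flip: sum_divide_distrib)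
    moreover have "norm (w (Suc k) - w k) \<le> 2 * sin (pi / n)" if k: "k < n" for k
    proof -
      have "w (Suc k) - w k = (z (Suc k) - z k) / of_real (r * g)"
        by (simp add: w_def diff_divide_distrib)
      then have "norm (w (Suc k) - w k) = dist (p (t (Suc k))) (p (t k)) / (r * g)"
        using r0 g0 by (simp add: norm_divide norm_z norm_mult)
      also have "\<dots> \<le> (L / n) / (r * g)"
      proof (intro divide_right_mono)
        have "dist (p (t (Suc k))) (p (t k)) \<le> measure hausdorff1 (p ` {t k..t (Suc k)})"
          using step[OF k] by (intro chord_le_arc fin) auto
        then show "dist (p (t (Suc k))) (p (t k)) \<le> L / n" using mass[OF k] by simp
      qed (use r0 g0 in simp)
      also have "\<dots> = 2 * sin (pi / n)"
        using r0 n0 sin_pos by (simp add: g_def L_r field_simps)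
      finally show ?thesis .
    qed
    ultimately show ?thesis
      using polygon_wirtinger_stability(2)[OF N n, of w] that by blast
  qed
  define \<eta> where "\<eta> = 1 - (\<Sum>k<n. (norm (w k))\<^sup>2) / n"
  define Q where "Q = (\<Sum>k<n. (norm (z k - m))\<^sup>2)"
  have Q: "Q = n * (r * g)\<^sup>2 * (1 - \<eta>)"
    using r0 g0 n0
    by (simp add: \<eta>_def w_def norm_divide norm_mult power_divide Q_def power_mult_distrib flip: sum_divide_distrib)

  have zL: "norm (z k - m) \<le> L" if "k < n" for k
  proof -
    have tr: "0 \<le> t j \<and> t j \<le> 2*pi" if "j < n" for j using step[OF that] by auto
    have "z k - m = (\<Sum>j<n. z k - z j) / n"
      using n0 by (simp add: m_def sum_subtractf diff_divide_distrib)
    then have "norm (z k - m) = norm (\<Sum>j<n. z k - z j) / n"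
      by (simp add: norm_divide)
    also have "\<dots> \<le> (\<Sum>j<n. L) / n"
      unfolding Lp using tr that
      by (intro divide_right_mono order_trans[OF norm_sum] sum_mono)
         (auto simp: norm_z intro!: chord_le_arc fin)
    finally show ?thesis using n0 by simp
  qed
  \<comment> \<open>Testing the infimum with the barycentre bounds \<open>\<eta>\<close> by the deficit of the set.\<close>
  have "(INF x\<^sub>0. LINT x:frontier E|hausdorff1. (norm (x - x\<^sub>0))\<^sup>2)
      \<le> (LINT x:frontier E|hausdorff1. (norm (x - c))\<^sup>2)"
    by (rule cINF_lower) (auto intro!: bdd_belowI[of _ 0] integral_nonneg simp: set_lebesgue_integral_def)
  also have "\<dots> \<le> L / n * (\<Sum>k<n. (norm (p (t k) - c) + L / n)\<^sup>2)"
    using second_moment_le_partition_sum[OF p(1) fin n0(1) t step mass, of c] p(2) by simp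
  also have "\<dots> \<le> L / n * (\<Sum>k<n. (norm (z k - m))\<^sup>2 + 3 * L\<^sup>2 / n)"
  proof (intro mult_left_mono sum_mono)
    fix k assume "k \<in> {..<n}"
    then have "norm (z k - m) * (L / n) \<le> L * (L / n)"
      using zL L0 by (intro mult_right_mono) auto
    moreover have "(L / n)\<^sup>2 \<le> L\<^sup>2 / n"
      using n0 by (simp add: power_divide power2_eq_square[of "real n"] divide_left_mono)
    ultimately show "(norm (p (t k) - c) + L / n)\<^sup>2 \<le> (norm (z k - m))\<^sup>2 + 3 * L\<^sup>2 / n"
      by (simp add: pm power2_sum power2_eq_square[of L])
  qed (use L0 in simp)
  also have "\<dots> = L / n * Q + 3 * L ^ 3 / n"
    unfolding sum.distrib Q_def[symmetric]
    using n0 by (simp add: distrib_left power2_eq_square power3_eq_cube)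
  finally have "(INF x\<^sub>0. LINT x:frontier E|hausdorff1. (norm (x - x\<^sub>0))\<^sup>2) / L ^ 3
      \<le> (L / n * Q + 3 * L ^ 3 / n) / L ^ 3"
    using L0 by (intro divide_right_mono) auto
  also have "\<dots> = g\<^sup>2 * (1 - \<eta>) / (4 * pi\<^sup>2) + 3 / n"
    using L0 n0 r0 unfolding Q L_r by (simp add: field_simps power2_eq_square power3_eq_cube)
  finally have "1 / (2 * pi)\<^sup>2 \<le> g\<^sup>2 * (1 - \<eta>) / (4 * pi\<^sup>2) + (\<Delta> + 3 / n)"
    by (simp add: \<Delta>_def L_def)
  from mult_left_mono[OF this, of "4 * pi\<^sup>2"]
  have "1 - 4 * pi\<^sup>2 * (\<Delta> + 3 / n) \<le> g\<^sup>2 * (1 - \<eta>)"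
    by (simp add: distrib_left power_mult_distrib)
  then have \<eta>: "\<eta> \<le> 1 - (1 - 4 * pi\<^sup>2 * (\<Delta> + 3 / n)) / g\<^sup>2"
    using g0 by (simp add: field_simps)

  \<comment> \<open>The points \<open>v k\<close> are the vertices of the nearby regular polygon, carried back to the scale of the set.\<close>
  define d where "d = r * (120 * g * sqrt \<eta> + \<bar>g - 1\<bar> + 2 * pi / n)"
  define v where "v k = c + r *\<^sub>R plane_of_complex (\<alpha> * mode n s k)" for k
  have v: "v k \<in> sphere c r" for k
    using r0 by (simp add: v_def dist_norm norm_mult \<alpha>)
  have pv: "dist (p (t k)) (v k) \<le> r * (120 * g * sqrt \<eta> + \<bar>g - 1\<bar>)" if k: "k < n" for k
  proof -
    have "p (t k) - v k = plane_of_complex (z k - m - r *\<^sub>R (\<alpha> * mode n s k))"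
      by (simp add: v_def plane_of_complex_diff plane_of_complex_scaleR z_def c_def)
    also have "z k - m - r *\<^sub>R (\<alpha> * mode n s k)
        = (r * g) *\<^sub>R (w k - \<alpha> * mode n s k) + (r * (g - 1)) *\<^sub>R (\<alpha> * mode n s k)"
    proof -
      have "z k - m = (r * g) *\<^sub>R w k"
        using r0 g0 by (simp add: w_def scaleR_conv_of_real)
      then show ?thesis by (simp add: algebra_simps)
    qed
    finally have "dist (p (t k)) (v k) \<le> (r * g) * norm (w k - \<alpha> * mode n s k) + r * \<bar>g - 1\<bar>"
      using norm_triangle_ineq[of "(r * g) *\<^sub>R (w k - \<alpha> * mode n s k)" "(r * (g - 1)) *\<^sub>R (\<alpha> * mode n s k)"] r0 g0
      by (simp add: dist_norm norm_mult \<alpha> abs_mult)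
    also have "\<dots> \<le> (r * g) * (120 * sqrt \<eta>) + r * \<bar>g - 1\<bar>"
      using close[OF k] r0 g0 by (intro add_mono mult_left_mono) (auto simp: \<eta>_def)
    finally show ?thesis by (simp add: algebra_simps)
  qed
  have d: "d = r * (120 * g * sqrt \<eta> + \<bar>g - 1\<bar>) + L / n"
    by (simp add: d_def L_r algebra_simps)
  have "hausdorff_dist (closure E) (closure (ball c r)) \<le> d"
  proof (rule hausdorff_dist_convex_ball_le[OF E(2-4) _ r0])
    show "frontier E \<noteq> {}" using p(2) by auto
    fix x assume "x \<in> frontier E"
    then obtain \<tau> where \<tau>: "x = p \<tau>" "0 \<le> \<tau>" "\<tau> \<le> 2*pi"
      unfolding p(2)[symmetric] by auto
    obtain k where k: "k < n" "t k \<le> \<tau>" "\<tau> \<le> t (Suc k)"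
      using partition_covers[of t \<tau> n] \<tau> t n0 by auto
    have "dist (p \<tau>) (p (t k)) \<le> measure hausdorff1 (p ` {t k..t (Suc k)})"
      using k step[OF k(1)] by (intro chord_le_arc fin) auto
    then have "dist x (v k) \<le> d"
      using mass[OF k(1)] pv[OF k(1)] dist_triangle[of x "v k" "p (t k)"] \<tau>(1) d by simp
    then show "\<exists>y\<in>sphere c r. dist x y \<le> d" using v by blast
  next
    fix y assume y: "y \<in> sphere c r"
    define \<zeta> where "\<zeta> = complex_of_plane ((1 / r) *\<^sub>R (y - c))"
    have "norm \<zeta> = 1" using y r0 by (simp add: \<zeta>_def dist_norm norm_minus_commute)
    then obtain k where k: "k < n" "norm (\<zeta> / \<alpha> - mode n s k) \<le> 2 * pi / n"
      using modes_dense_in_circle[of "\<zeta> / \<alpha>" s n] s n0 \<alpha> by (auto simp: norm_divide)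
    have "\<alpha> \<noteq> 0" using \<alpha> by auto
    then have "norm (\<zeta> - \<alpha> * mode n s k) = norm (\<zeta> / \<alpha> - mode n s k)"
      using \<alpha> norm_mult[of \<alpha> "\<zeta> / \<alpha> - mode n s k"] by (simp add: right_diff_distrib)
    then have "norm (\<zeta> - \<alpha> * mode n s k) \<le> 2 * pi / n" using k by simp
    moreover have "y = c + r *\<^sub>R plane_of_complex \<zeta>" using r0 by (simp add: \<zeta>_def)
    then have "dist y (v k) = r * norm (\<zeta> - \<alpha> * mode n s k)"
      using r0 by (simp add: v_def dist_norm flip: scaleR_diff_right plane_of_complex_diff)
    ultimately have "dist y (v k) \<le> L / n"
      using mult_left_mono[of "norm (\<zeta> - \<alpha> * mode n s k)" "2 * pi / n" r] r0 by (simp add: L_r algebra_simps)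
    then have "dist y (p (t k)) \<le> d"
      using pv[OF k(1)] dist_triangle[of y "p (t k)" "v k"] d by (simp add: dist_commute)
    moreover have "p (t k) \<in> frontier E"
      unfolding p(2)[symmetric] using step[OF k(1)] by (intro imageI) auto
    ultimately show "\<exists>x\<in>frontier E. dist y x \<le> d" by blast
  qed
  then have "hausdorff_dist (closure E) (closure (ball c r)) / r \<le> d / r"
    using r0 by (intro divide_right_mono) auto
  then have "asymmetry E \<le> d / r"
    using asymmetry_bounds(2)[OF E, of c] unfolding r_def L_def by linarith
  also have "\<dots> = 120 * g * sqrt \<eta> + \<bar>g - 1\<bar> + 2 * pi / n"
    using r0 by (simp add: d_def)
  also have "\<dots> \<le> 120 * g * sqrt (1 - (1 - 4 * pi\<^sup>2 * (\<Delta> + 3 / n)) / g\<^sup>2) + \<bar>g - 1\<bar> + 2 * pi / n"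
    using \<eta> g0 by simp
  finally show ?thesis .
qed

text \<open>
  The constant is \<open>1 / (2 * pi * 120)\<^sup>2\<close>: in the limit of fine partitions the asymmetry is at most \<open>120\<close> times the
  square root of \<open>(2 * pi)\<^sup>2\<close> times the deficit.
\<close>

theorem corollary1p5:
  shows "\<exists>C>0. \<forall>E :: (real^2) set. E \<noteq> {} \<and> open E \<and> bounded E \<and> convex E \<longrightarrow>
    1 / (2 * pi)\<^sup>2
      - (INF x\<^sub>0. LINT x:frontier E|hausdorff1. (norm (x - x\<^sub>0))\<^sup>2) / perimeter E ^ 3
    \<ge> C * (asymmetry E)\<^sup>2"
proof (intro exI[of _ "1 / (240 * pi)\<^sup>2"] conjI allI impI)
  fix E :: "(real^2) set"
  assume "E \<noteq> {} \<and> open E \<and> bounded E \<and> convex E"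
  then have E: "E \<noteq> {}" "open E" "bounded E" "convex E" by auto
  define \<Delta> where "\<Delta> = 1 / (2 * pi)\<^sup>2
      - (INF x\<^sub>0. LINT x:frontier E|hausdorff1. (norm (x - x\<^sub>0))\<^sup>2) / perimeter E ^ 3"
  define g where "g N = (pi / real (2 * N + 1)) / sin (pi / real (2 * N + 1))" for N
  have g: "g \<longlonglongrightarrow> 1"
    unfolding g_def by real_asymp
  have inv: "(\<lambda>N. 3 / real (2 * N + 1)) \<longlonglongrightarrow> 0" "(\<lambda>N. 2 * pi / real (2 * N + 1)) \<longlonglongrightarrow> 0"
    by real_asymp+
  have "(\<lambda>N. 120 * g N * sqrt (1 - (1 - 4 * pi\<^sup>2 * (\<Delta> + 3 / real (2 * N + 1))) / (g N)\<^sup>2)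
          + \<bar>g N - 1\<bar> + 2 * pi / real (2 * N + 1))
      \<longlonglongrightarrow> 120 * 1 * sqrt (1 - (1 - 4 * pi\<^sup>2 * (\<Delta> + 0)) / 1\<^sup>2) + \<bar>1 - 1\<bar> + 0"
    by (intro tendsto_intros g inv) auto
  then have lim: "(\<lambda>N. 120 * g N * sqrt (1 - (1 - 4 * pi\<^sup>2 * (\<Delta> + 3 / real (2 * N + 1))) / (g N)\<^sup>2)
          + \<bar>g N - 1\<bar> + 2 * pi / real (2 * N + 1))
      \<longlonglongrightarrow> 120 * sqrt (4 * pi\<^sup>2 * \<Delta>)"
    by simp
  have "asymmetry E \<le> 120 * g N * sqrt (1 - (1 - 4 * pi\<^sup>2 * (\<Delta> + 3 / real (2 * N + 1))) / (g N)\<^sup>2)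
          + \<bar>g N - 1\<bar> + 2 * pi / real (2 * N + 1)" if "N \<ge> 2" for N
    unfolding g_def \<Delta>_def by (rule asymmetry_le_discrete[OF E that refl])
  then have le: "asymmetry E \<le> 120 * sqrt (4 * pi\<^sup>2 * \<Delta>)"
    by (intro LIMSEQ_le_const[OF lim]) blast
  then have "0 \<le> 4 * pi\<^sup>2 * \<Delta>"
    using order_trans[OF asymmetry_bounds(1)[OF E] le] by (simp del: real_sqrt_mult)
  then have "(asymmetry E)\<^sup>2 \<le> 120\<^sup>2 * (4 * pi\<^sup>2 * \<Delta>)"
    using power_mono[OF le asymmetry_bounds(1)[OF E], of 2] by (simp add: power_mult_distrib)
  then have "1 / (240 * pi)\<^sup>2 * (asymmetry E)\<^sup>2 \<le> \<Delta>"
    by (simp add: field_simps power_mult_distrib)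
  then show "1 / (2 * pi)\<^sup>2
      - (INF x\<^sub>0. LINT x:frontier E|hausdorff1. (norm (x - x\<^sub>0))\<^sup>2) / perimeter E ^ 3
      \<ge> 1 / (240 * pi)\<^sup>2 * (asymmetry E)\<^sup>2"
    by (simp add: \<Delta>_def)
qed simp

end
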